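(* Let $D,\tilde X,Q\in\mathbb{R}^{m\times n}$, $\xi>0$, $\rho>0$ and $\delta\ge0$, and consider the problem $$(P_{ns}):\ \min_{X,S\in\mathbb{R}^{m\times n}}\left\{\xi\|S\|_1+\langle Q,X-\tilde X\rangle+\frac{\rho}{2}\|X-\tilde X\|_F^2:\ \|X+S-D\|_F\le\delta\right\}.$$ Let $q(\tilde X):=\tilde X-\frac1\rho Q$. The optimal solution $(X^*,S^* )$ to $(P_{ns})$ can be written in closed form as follows. When $\delta>0$, $$S^*=\operatorname{sign}\left(D-q(\tilde X)\right)\odot\max\left\{|D-q(\tilde X)|-\xi\frac{\rho+\theta^*}{\rho\theta^*}E,\ \mathbf{0}\right\},$$ $$X^*=\frac{\theta^*}{\rho+\theta^*}(D-S^* )+\frac{\rho}{\rho+\theta^*}q(\tilde X),$$ where $\theta^*=0$ if $\|D-q(\tilde X)\|_F\le\delta$; otherwise, $\theta^*$ is the unique positive solution of the nonlinear equation $\phi(\theta)=\delta$, where $$\phi(\theta):=\left\|\min\left\{\frac{\xi}{\theta}E,\ \frac{\rho}{\rho+\theta}|D-q(\tilde X)|\right\}\right\|_F.$$ (When $\theta^*=0$, the formula for $S^*$ is read as $S^*=\mathbf{0}$.) Moreover, $\theta^*$ can be efficiently computed in $\mathcal{O}(mn\log(mn))$ time. When $\delta=0$, $$S^*=\operatorname{sign}\left(D-q(\tilde X)\right)\odot\max\left\{|D-q(\tilde X)|-\frac{\xi}{\rho}E,\ \mathbf{0}\right\}\quad\text{and}\quad X^*=D-S^*.$$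
   Context: $\|S\|_1=\sum_{i,j}|S_{ij}|$, $\|\cdot\|_F$ is the Frobenius norm, $\langle\cdot,\cdot\rangle$ the trace inner product. $E$ and $\mathbf{0}\in\mathbb{R}^{m\times n}$ are the matrices with all entries equal to one and zero respectively; $\odot$ is the componentwise product; $\operatorname{sign}$, $|\cdot|$, $\max$ and $\min$ of matrices are taken componentwise. Time is counted in elementary operations on real numbers (arithmetic, comparisons, and solving a quartic equation by radicals count as $\mathcal{O}(1)$). *)

theory Defs
  imports Complex_Main "Jordan_Normal_Form.Matrix"
begin

section \<open>Matrix operations\<close>

definition ones_mat :: "nat \<Rightarrow> nat \<Rightarrow> real mat" where
  "ones_mat m n = mat m n (\<lambda>_. 1)"

definition comp_mat :: "(real \<Rightarrow> real \<Rightarrow> real) \<Rightarrow> real mat \<Rightarrow> real mat \<Rightarrow> real mat" where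
  "comp_mat f A B = mat (dim_row A) (dim_col A) (\<lambda>ij. f (A $$ ij) (B $$ ij))"

abbreviation hadamard :: "real mat \<Rightarrow> real mat \<Rightarrow> real mat" (infixl \<open>\<odot>\<close> 70) where
  "A \<odot> B \<equiv> comp_mat (*) A B"

abbreviation max_mat :: "real mat \<Rightarrow> real mat \<Rightarrow> real mat" where
  "max_mat \<equiv> comp_mat max"

abbreviation min_mat :: "real mat \<Rightarrow> real mat \<Rightarrow> real mat" where
  "min_mat \<equiv> comp_mat min"

abbreviation abs_mat :: "real mat \<Rightarrow> real mat" where
  "abs_mat \<equiv> map_mat abs"

abbreviation sign_mat :: "real mat \<Rightarrow> real mat" where
  "sign_mat \<equiv> map_mat sgn"

definition l1_norm :: "real mat \<Rightarrow> real" where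
  "l1_norm A = sum_mat (abs_mat A)"

definition fro_norm :: "real mat \<Rightarrow> real" where
  "fro_norm A = sqrt (sum_mat (map_mat (\<lambda>x. x\<^sup>2) A))"

definition trace_inner :: "real mat \<Rightarrow> real mat \<Rightarrow> real" where
  "trace_inner A B = sum_list (diag_mat (A\<^sup>T * B))"


section \<open>The optimization problem\<close>

definition objective :: "real \<Rightarrow> real \<Rightarrow> real mat \<Rightarrow> real mat \<Rightarrow> real mat \<Rightarrow> real mat \<Rightarrow> real" where
  "objective \<xi> \<rho> Q Xt X S =
     \<xi> * l1_norm S + trace_inner Q (X - Xt) + \<rho> / 2 * (fro_norm (X - Xt))\<^sup>2"

definition feasible :: "nat \<Rightarrow> nat \<Rightarrow> real \<Rightarrow> real mat \<Rightarrow> real mat \<Rightarrow> real mat \<Rightarrow> bool" where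
  "feasible m n \<delta> D X S \<longleftrightarrow>
     X \<in> carrier_mat m n \<and> S \<in> carrier_mat m n \<and> fro_norm (X + S - D) \<le> \<delta>"

definition optimal_solution ::
  "nat \<Rightarrow> nat \<Rightarrow> real \<Rightarrow> real \<Rightarrow> real \<Rightarrow> real mat \<Rightarrow> real mat \<Rightarrow> real mat \<Rightarrow> real mat \<Rightarrow> real mat \<Rightarrow> bool" where
  "optimal_solution m n \<xi> \<rho> \<delta> D Xt Q X S \<longleftrightarrow>
     feasible m n \<delta> D X S \<and>
     (\<forall>X' S'. feasible m n \<delta> D X' S' \<longrightarrow> objective \<xi> \<rho> Q Xt X S \<le> objective \<xi> \<rho> Q Xt X' S')"


section \<open>The closed form\<close>

definition q_mat :: "real \<Rightarrow> real mat \<Rightarrow> real mat \<Rightarrow> real mat" where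
  "q_mat \<rho> Q Xt = Xt - (1 / \<rho>) \<cdot>\<^sub>m Q"

text \<open>In the remaining definitions of this section, \<open>R\<close> stands for the residual \<open>D - q_mat \<rho> Q Xt\<close>.\<close>

definition phi :: "real \<Rightarrow> real \<Rightarrow> real mat \<Rightarrow> real \<Rightarrow> real" where
  "phi \<xi> \<rho> R \<theta> =
     fro_norm (min_mat ((\<xi> / \<theta>) \<cdot>\<^sub>m ones_mat (dim_row R) (dim_col R))
                       ((\<rho> / (\<rho> + \<theta>)) \<cdot>\<^sub>m abs_mat R))"

definition theta_star :: "real \<Rightarrow> real \<Rightarrow> real \<Rightarrow> real mat \<Rightarrow> real" where
  "theta_star \<xi> \<rho> \<delta> R =
     (if fro_norm R \<le> \<delta> then 0 else (THE \<theta>. \<theta> > 0 \<and> phi \<xi> \<rho> R \<theta> = \<delta>))"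

definition shrink :: "real mat \<Rightarrow> real \<Rightarrow> real mat" where
  "shrink R c =
     sign_mat R \<odot> max_mat (abs_mat R - c \<cdot>\<^sub>m ones_mat (dim_row R) (dim_col R))
                          (0\<^sub>m (dim_row R) (dim_col R))"

text \<open>For \<open>\<theta> = 0\<close> the threshold is formally infinite, so the shrinkage is zero; with
  \<open>x / 0 = 0\<close> the general formula would give \<open>R\<close> instead, hence the case distinction.\<close>

definition S_star :: "real \<Rightarrow> real \<Rightarrow> real mat \<Rightarrow> real \<Rightarrow> real mat" where
  "S_star \<xi> \<rho> R \<theta> =
     (if \<theta> = 0 then 0\<^sub>m (dim_row R) (dim_col R)
      else shrink R (\<xi> * ((\<rho> + \<theta>) / (\<rho> * \<theta>))))"

definition X_star :: "real \<Rightarrow> real mat \<Rightarrow> real mat \<Rightarrow> real \<Rightarrow> real mat \<Rightarrow> real mat" where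
  "X_star \<rho> D q \<theta> S = (\<theta> / (\<rho> + \<theta>)) \<cdot>\<^sub>m (D - S) + (\<rho> / (\<rho> + \<theta>)) \<cdot>\<^sub>m q"


section \<open>Real random access machines\<close>

text \<open>
  Running time is measured for programs of a while language over a memory with natural-number
  variables (used as indices and loop counters) and arrays of exact real numbers. A program is a
  finite object independent of the input dimensions. The real primitives are arithmetic,
  comparisons and the solution of a quartic equation; each costs one unit. Every memory access,
  constant, index operation, assignment and branch is charged one unit as well, so that the cost
  is an upper bound for the number of real operations.
\<close>

datatype iexp =
    INum nat
  | IVar string
  | IAdd iexp iexp
  | ISub iexp iexp
  | IMul iexp iexp

datatype rexp =
    RNum int
  | RCell string iexp
  | RAdd rexp rexp
  | RSub rexp rexp
  | RMul rexp rexp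
  | RDiv rexp rexp

datatype bexp =
    ILess iexp iexp
  | IEq iexp iexp
  | RLess rexp rexp
  | REq rexp rexp
  | BNot bexp
  | BAnd bexp bexp

text \<open>\<open>Quartic x l a4 a3 a2 a1 a0\<close> writes the distinct real roots of the quartic with these
  coefficients (highest degree first) to array \<open>x\<close> and their number to index variable \<open>l\<close>.\<close>

datatype com =
    Skip
  | ISet string iexp
  | RSet string iexp rexp
  | Quartic string string rexp rexp rexp rexp rexp
  | Seq com com
  | Cond bexp com com
  | While bexp com

type_synonym store = "(string \<Rightarrow> nat) \<times> (string \<Rightarrow> nat \<Rightarrow> real)"

text \<open>Subtraction of indices is truncated at zero, and real division by zero yields zero.\<close>

primrec ival :: "iexp \<Rightarrow> store \<Rightarrow> nat" where
  "ival (INum k) s = k"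
| "ival (IVar x) s = fst s x"
| "ival (IAdd a b) s = ival a s + ival b s"
| "ival (ISub a b) s = ival a s - ival b s"
| "ival (IMul a b) s = ival a s * ival b s"

primrec rval :: "rexp \<Rightarrow> store \<Rightarrow> real" where
  "rval (RNum k) s = of_int k"
| "rval (RCell x i) s = snd s x (ival i s)"
| "rval (RAdd a b) s = rval a s + rval b s"
| "rval (RSub a b) s = rval a s - rval b s"
| "rval (RMul a b) s = rval a s * rval b s"
| "rval (RDiv a b) s = rval a s / rval b s"

primrec bval :: "bexp \<Rightarrow> store \<Rightarrow> bool" where
  "bval (ILess a b) s \<longleftrightarrow> ival a s < ival b s"
| "bval (IEq a b) s \<longleftrightarrow> ival a s = ival b s"
| "bval (RLess a b) s \<longleftrightarrow> rval a s < rval b s"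
| "bval (REq a b) s \<longleftrightarrow> rval a s = rval b s"
| "bval (BNot b) s \<longleftrightarrow> \<not> bval b s"
| "bval (BAnd b c) s \<longleftrightarrow> bval b s \<and> bval c s"

primrec icost :: "iexp \<Rightarrow> nat" where
  "icost (INum k) = 1"
| "icost (IVar x) = 1"
| "icost (IAdd a b) = icost a + icost b + 1"
| "icost (ISub a b) = icost a + icost b + 1"
| "icost (IMul a b) = icost a + icost b + 1"

primrec rcost :: "rexp \<Rightarrow> nat" where
  "rcost (RNum k) = 1"
| "rcost (RCell x i) = icost i + 1"
| "rcost (RAdd a b) = rcost a + rcost b + 1"
| "rcost (RSub a b) = rcost a + rcost b + 1"
| "rcost (RMul a b) = rcost a + rcost b + 1"
| "rcost (RDiv a b) = rcost a + rcost b + 1"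

primrec bcost :: "bexp \<Rightarrow> nat" where
  "bcost (ILess a b) = icost a + icost b + 1"
| "bcost (IEq a b) = icost a + icost b + 1"
| "bcost (RLess a b) = rcost a + rcost b + 1"
| "bcost (REq a b) = rcost a + rcost b + 1"
| "bcost (BNot b) = bcost b + 1"
| "bcost (BAnd b c) = bcost b + bcost c + 1"

text \<open>The distinct real roots, in increasing order, of a polynomial of degree exactly four.\<close>

definition quartic_roots :: "real \<Rightarrow> real \<Rightarrow> real \<Rightarrow> real \<Rightarrow> real \<Rightarrow> real list" where
  "quartic_roots c4 c3 c2 c1 c0 =
     (if c4 = 0 then []
      else sorted_list_of_set {x. c4 * x ^ 4 + c3 * x ^ 3 + c2 * x\<^sup>2 + c1 * x + c0 = 0})"

definition set_index :: "string \<Rightarrow> nat \<Rightarrow> store \<Rightarrow> store" where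
  "set_index x k s = ((fst s)(x := k), snd s)"

definition set_cell :: "string \<Rightarrow> nat \<Rightarrow> real \<Rightarrow> store \<Rightarrow> store" where
  "set_cell x i r s = (fst s, (snd s)(x := (snd s x)(i := r)))"

text \<open>\<open>store_list x l rs s\<close> puts the entries of \<open>rs\<close> at the beginning of array \<open>x\<close> and their
  number into index variable \<open>l\<close>.\<close>

definition store_list :: "string \<Rightarrow> string \<Rightarrow> real list \<Rightarrow> store \<Rightarrow> store" where
  "store_list x l rs s =
     ((fst s)(l := length rs),
      (snd s)(x := (\<lambda>i. if i < length rs then rs ! i else snd s x i)))"

text \<open>\<open>exec c s t s'\<close>: started in \<open>s\<close>, program \<open>c\<close> terminates in \<open>s'\<close> after \<open>t\<close> time units.\<close>

inductive exec :: "com \<Rightarrow> store \<Rightarrow> nat \<Rightarrow> store \<Rightarrow> bool" where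
  exec_Skip: "exec Skip s 1 s"
| exec_ISet: "exec (ISet x a) s (icost a + 1) (set_index x (ival a s) s)"
| exec_RSet: "exec (RSet x i a) s (icost i + rcost a + 1) (set_cell x (ival i s) (rval a s) s)"
| exec_Quartic:
    "exec (Quartic x l a4 a3 a2 a1 a0) s
       (rcost a4 + rcost a3 + rcost a2 + rcost a1 + rcost a0 + 1)
       (store_list x l
          (quartic_roots (rval a4 s) (rval a3 s) (rval a2 s) (rval a1 s) (rval a0 s)) s)"
| exec_Seq: "exec c s t s' \<Longrightarrow> exec d s' t' s'' \<Longrightarrow> exec (Seq c d) s (t + t') s''"
| exec_CondTrue: "bval b s \<Longrightarrow> exec c s t s' \<Longrightarrow> exec (Cond b c d) s (bcost b + t + 1) s'"
| exec_CondFalse: "\<not> bval b s \<Longrightarrow> exec d s t s' \<Longrightarrow> exec (Cond b c d) s (bcost b + t + 1) s'"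
| exec_WhileFalse: "\<not> bval b s \<Longrightarrow> exec (While b c) s (bcost b + 1) s"
| exec_WhileTrue:
    "bval b s \<Longrightarrow> exec c s t s' \<Longrightarrow> exec (While b c) s' t' s'' \<Longrightarrow>
     exec (While b c) s (bcost b + t + t' + 1) s''"

text \<open>Matrices are passed row by row; scalars occupy cell 0. Everything else is initially zero.\<close>

definition mat_array :: "real mat \<Rightarrow> nat \<Rightarrow> real" where
  "mat_array A k =
     (if k < dim_row A * dim_col A then A $$ (k div dim_col A, k mod dim_col A) else 0)"

definition scalar_array :: "real \<Rightarrow> nat \<Rightarrow> real" where
  "scalar_array r = (\<lambda>_. 0)(0 := r)"

definition input_store ::
  "nat \<Rightarrow> nat \<Rightarrow> real \<Rightarrow> real \<Rightarrow> real \<Rightarrow> real mat \<Rightarrow> real mat \<Rightarrow> real mat \<Rightarrow> store" where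
  "input_store m n \<xi> \<rho> \<delta> D Xt Q =
     ((\<lambda>_. 0)(''m'' := m, ''n'' := n),
      (\<lambda>_ _. 0)(''D'' := mat_array D, ''Xt'' := mat_array Xt, ''Q'' := mat_array Q,
        ''xi'' := scalar_array \<xi>, ''rho'' := scalar_array \<rho>, ''delta'' := scalar_array \<delta>))"

definition theta_output :: "store \<Rightarrow> real" where
  "theta_output s = snd s ''theta'' 0"

end

theory Submission
  imports Defs "HOL-Library.Multiset" "HOL-Computational_Algebra.Polynomial"
begin

text \<open>
  Write \<open>q = q_mat \<rho> Q Xt\<close>, \<open>R = D - q\<close> and let \<open>Z = D - X - S\<close> be the slack of the constraint, so
  that feasibility means that \<open>Z\<close> lies in the Frobenius ball of radius \<open>\<delta>\<close>.

  \<^bold>\<open>Closed form.\<close> Up to a constant the objective is \<open>\<xi> * l1_norm S + \<rho> / 2 * (fro_norm (X - q))\<^sup>2\<close>, and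
  \<open>X - q = R - S - Z\<close>. The optimality conditions ask that \<open>\<rho> \<cdot> (X - q)\<close> be a subgradient of
  \<open>\<xi> * l1_norm\<close> at \<open>S\<close> and an outer normal of the ball at \<open>Z\<close>. For an active constraint the normal is
  \<open>\<theta> \<cdot> Z\<close> with \<open>\<theta> > 0\<close>; eliminating \<open>Z\<close> turns the subgradient condition into soft thresholding of
  \<open>R\<close>, and the entries of the resulting \<open>Z\<close> are, up to sign, those inside the norm in \<open>phi\<close>. So
  \<open>phi = \<delta>\<close> says that \<open>Z\<close> lies on the boundary of the ball. That the conditions are sufficient, and
  that the optimum is unique although the objective is not strictly convex in \<open>S\<close>, follows from
  keeping the quadratic remainders in \<open>X\<close> and \<open>Z\<close> (\<open>optimal_solution_certificate\<close>): they force equality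
  of \<open>X\<close> and \<open>Z\<close>, hence of \<open>S\<close>. For \<open>\<delta> = 0\<close> the slack vanishes anyway, and if \<open>fro_norm R \<le> \<delta>\<close> then
  \<open>S = 0\<close>, \<open>X = q\<close> minimise both summands at once.

  \<^bold>\<open>The multiplier.\<close> The square of \<open>phi\<close> is a sum over the squared entries of \<open>R\<close> (\<open>clipped_sum\<close>).
  Unless \<open>R = 0\<close>, it decreases strictly in \<open>\<theta>\<close>, from \<open>(fro_norm R)\<^sup>2\<close> at \<open>0\<close> to \<open>0\<close> at infinity, whence
  the unique root (\<open>phi_root_unique\<close>).

  \<^bold>\<open>Running time.\<close> The entries clipped at \<open>\<theta>\<close> are the largest ones. For each \<open>K\<close> the assumption
  that exactly the \<open>K\<close> largest squares are clipped turns the equation into a quartic, whose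
  coefficients depend only on \<open>K\<close> and on the sum \<open>B\<close> of the other squares. That quartic has at most
  one positive root (\<open>quartic_equation_root_unique\<close>), and this root is the solution if its threshold
  separates the \<open>K\<close> largest squares from the others; conversely the solution arises in this way for
  some \<open>K\<close>. So it suffices to remove the squares from a heap in decreasing order, to update \<open>B\<close>, and
  to test one candidate per step. This takes \<open>m * n + 1\<close> quartics and \<open>2 * m * n\<close> heap operations of
  logarithmic cost.
\<close>

section \<open>Entrywise descriptions\<close>

abbreviation indices :: "real mat \<Rightarrow> (nat \<times> nat) set" where
  "indices A \<equiv> {0..<dim_row A} \<times> {0..<dim_col A}"

lemma fro_norm_squared: "(fro_norm A)\<^sup>2 = (\<Sum>p\<in>indices A. (A $$ p)\<^sup>2)"
proof -
  have "sum_mat (map_mat (\<lambda>x. x\<^sup>2) A) = (\<Sum>p\<in>indices A. (A $$ p)\<^sup>2)"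
    unfolding sum_mat_def by (intro sum.cong) auto
  then show ?thesis
    by (simp add: fro_norm_def sum_nonneg)
qed

lemma fro_norm_nonneg: "0 \<le> fro_norm A"
  by (auto simp: fro_norm_def sum_mat_def intro!: sum_nonneg)

lemma l1_norm_entries: "l1_norm A = (\<Sum>p\<in>indices A. \<bar>A $$ p\<bar>)"
  by (auto simp: l1_norm_def sum_mat_def intro!: sum.cong)

lemma trace_inner_entries:
  assumes "A \<in> carrier_mat m n" "B \<in> carrier_mat m n"
  shows "trace_inner A B = (\<Sum>p\<in>{0..<m} \<times> {0..<n}. A $$ p * B $$ p)"
proof -
  have "trace_inner A B = (\<Sum>j = 0..<n. \<Sum>i = 0..<m. A $$ (i, j) * B $$ (i, j))"
    using assms
    by (auto simp: trace_inner_def diag_mat_def scalar_prod_def interv_sum_list_conv_sum_set_nat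
             intro!: sum.cong)
  also have "\<dots> = (\<Sum>i = 0..<m. \<Sum>j = 0..<n. A $$ (i, j) * B $$ (i, j))"
    by (rule sum.swap)
  also have "\<dots> = (\<Sum>p\<in>{0..<m} \<times> {0..<n}. A $$ p * B $$ p)"
    by (simp add: sum.cartesian_product case_prod_unfold)
  finally show ?thesis .
qed

lemma objective_entries:
  assumes "Q \<in> carrier_mat m n" "Xt \<in> carrier_mat m n" "X \<in> carrier_mat m n" "S \<in> carrier_mat m n"
  shows "objective \<xi> \<rho> Q Xt X S =
    (\<Sum>p\<in>{0..<m} \<times> {0..<n}. \<xi> * \<bar>S $$ p\<bar> + Q $$ p * (X $$ p - Xt $$ p)
       + \<rho> / 2 * (X $$ p - Xt $$ p)\<^sup>2)"
proof -
  have *: "X - Xt \<in> carrier_mat m n"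
    using assms by (intro minus_carrier_mat)
  have e: "(X - Xt) $$ p = X $$ p - Xt $$ p" if "p \<in> {0..<m} \<times> {0..<n}" for p
    using that assms by auto
  show ?thesis
    unfolding objective_def trace_inner_entries[OF assms(1) *] l1_norm_entries fro_norm_squared
    using assms e by (simp add: sum.distrib sum_distrib_left)
qed

lemma mat_eq_entries:
  assumes "A \<in> carrier_mat m n" "B \<in> carrier_mat m n" "\<And>p. p \<in> {0..<m} \<times> {0..<n} \<Longrightarrow> A $$ p = B $$ p"
  shows "A = B"
  using assms by (intro eq_matI) auto

lemma q_mat_carrier:
  "Q \<in> carrier_mat m n \<Longrightarrow> Xt \<in> carrier_mat m n \<Longrightarrow> q_mat \<rho> Q Xt \<in> carrier_mat m n"
  by (simp add: q_mat_def minus_carrier_mat)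

lemma q_mat_entry:
  "Q \<in> carrier_mat m n \<Longrightarrow> Xt \<in> carrier_mat m n \<Longrightarrow> p \<in> {0..<m} \<times> {0..<n} \<Longrightarrow>
    q_mat \<rho> Q Xt $$ p = Xt $$ p - Q $$ p / \<rho>"
  by (auto simp: q_mat_def)

section \<open>Optimality of the closed form\<close>

text \<open>The quadratic terms have the exact expansion \<open>g * (x' - x) + \<rho> / 2 * (x' - x)\<^sup>2\<close> around \<open>x\<close>, and
  \<open>x' - x\<close> splits into the changes of \<open>s\<close> and of the slack \<open>z = d - x - s\<close>. The subgradient inequality
  absorbs the change of \<open>s\<close>, so the objective can only be lowered through the slack.\<close>

lemma subgradient_gap:
  fixes x :: real
  assumes "\<rho> > 0" "q = xt - Q / \<rho>" "g = \<rho> * (x - q)" "\<xi> * \<bar>s'\<bar> \<ge> \<xi> * \<bar>s\<bar> + g * (s' - s)"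
  shows "\<xi> * \<bar>s\<bar> + Q * (x - xt) + \<rho> / 2 * (x - xt)\<^sup>2
      - g * ((d - x' - s') - (d - x - s)) + \<rho> / 2 * (x' - x)\<^sup>2
    \<le> \<xi> * \<bar>s'\<bar> + Q * (x' - xt) + \<rho> / 2 * (x' - xt)\<^sup>2"
proof -
  have "Q = \<rho> * (xt - q)"
    using assms by (simp add: field_simps)
  then have Q: "Q = \<rho> * xt - \<rho> * q"
    by (simp add: algebra_simps)
  have "Q * (x' - xt) + \<rho> / 2 * (x' - xt)\<^sup>2 =
      Q * (x - xt) + \<rho> / 2 * (x - xt)\<^sup>2 + g * (x' - x) + \<rho> / 2 * (x' - x)\<^sup>2"
    unfolding assms(3) Q by (simp add: power2_eq_square field_simps)
  moreover have "g * ((d - x' - s') - (d - x - s)) = - g * (x' - x) - g * (s' - s)"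
    by (simp add: algebra_simps)
  ultimately show ?thesis
    using assms(4) by (simp add: algebra_simps)
qed

lemma soft_threshold_residual:
  fixes r :: real
  assumes "c \<ge> 0"
  shows "r - sgn r * max (\<bar>r\<bar> - c) 0 = sgn r * min \<bar>r\<bar> c"
  using assms by (auto simp: sgn_if max_def min_def)

text \<open>Soft thresholding at \<open>c\<close> is the proximal map of \<open>c * \<bar>\<cdot>\<bar>\<close>, so \<open>r - s\<close> is a subgradient of
  \<open>c * \<bar>\<cdot>\<bar>\<close> at \<open>s\<close>; scaling by \<open>\<xi> / c\<close> gives one of \<open>\<xi> * \<bar>\<cdot>\<bar>\<close>.\<close>

lemma soft_threshold_subgradient:
  fixes r :: real
  assumes "c > 0" "\<xi> > 0" "s = sgn r * max (\<bar>r\<bar> - c) 0" "g = \<xi> / c * (r - s)"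
  shows "\<xi> * \<bar>s\<bar> + g * (s' - s) \<le> \<xi> * \<bar>s'\<bar>"
proof -
  have g: "g = \<xi> * (sgn r * min \<bar>r\<bar> c / c)"
    using assms soft_threshold_residual[of c r] by simp
  have "\<bar>sgn r * (min \<bar>r\<bar> c / c)\<bar> \<le> 1"
    using assms(1) by (auto simp: abs_mult abs_sgn_eq)
  then have "\<xi> * \<bar>sgn r * (min \<bar>r\<bar> c / c)\<bar> \<le> \<xi>"
    using assms(2) by (intro mult_left_le) auto
  then have "\<bar>g\<bar> \<le> \<xi>"
    using assms(2) by (simp add: g abs_mult)
  then have "\<bar>g * s'\<bar> \<le> \<xi> * \<bar>s'\<bar>"
    unfolding abs_mult by (intro mult_right_mono) auto
  then have "g * s' \<le> \<xi> * \<bar>s'\<bar>"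
    by linarith
  moreover have "g * s = \<xi> * \<bar>s\<bar>"
  proof (cases "\<bar>r\<bar> \<le> c")
    case True
    then show ?thesis by (simp add: assms(3))
  next
    case False
    then show ?thesis
      using assms(1) by (auto simp: g assms(3) sgn_if abs_if min_def max_def)
  qed
  ultimately show ?thesis
    by (simp add: algebra_simps)
qed

lemma shrink_carrier: "R \<in> carrier_mat m n \<Longrightarrow> shrink R c \<in> carrier_mat m n"
  by (simp add: shrink_def comp_mat_def)

lemma shrink_entry:
  "R \<in> carrier_mat m n \<Longrightarrow> p \<in> {0..<m} \<times> {0..<n} \<Longrightarrow>
    shrink R c $$ p = sgn (R $$ p) * max (\<bar>R $$ p\<bar> - c) 0"
  by (auto simp: shrink_def comp_mat_def ones_mat_def)

lemma fro_norm_le_iff: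
  assumes "A \<in> carrier_mat m n" "\<delta> \<ge> 0"
  shows "fro_norm A \<le> \<delta> \<longleftrightarrow> (\<Sum>p\<in>{0..<m} \<times> {0..<n}. (A $$ p)\<^sup>2) \<le> \<delta>\<^sup>2"
  using fro_norm_squared[of A] fro_norm_nonneg[of A] assms
  by (metis carrier_matD abs_le_square_iff abs_of_nonneg)

lemma feasible_iff:
  assumes "D \<in> carrier_mat m n" "X \<in> carrier_mat m n" "S \<in> carrier_mat m n" "\<delta> \<ge> 0"
  shows "feasible m n \<delta> D X S \<longleftrightarrow>
    (\<Sum>p\<in>{0..<m} \<times> {0..<n}. (D $$ p - X $$ p - S $$ p)\<^sup>2) \<le> \<delta>\<^sup>2"
proof -
  have "(\<Sum>p\<in>{0..<m} \<times> {0..<n}. ((X + S - D) $$ p)\<^sup>2) =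
      (\<Sum>p\<in>{0..<m} \<times> {0..<n}. (D $$ p - X $$ p - S $$ p)\<^sup>2)"
    using assms by (intro sum.cong) (auto simp: power2_eq_square algebra_simps)
  moreover have "X + S - D \<in> carrier_mat m n"
    using assms(1) by (rule minus_carrier_mat)
  ultimately show ?thesis
    using assms fro_norm_le_iff[of "X + S - D" m n \<delta>] by (simp add: feasible_def)
qed

text \<open>A certificate for the unique minimiser. The dual variable is \<open>g = \<rho> * (X - q)\<close>; the
  last hypothesis says that \<open>g\<close> pairs with changes of the slack like the outer normal of a
  ball, with a modulus that forces equality of the slacks.\<close>

lemma optimal_solution_certificate:
  assumes carrier: "D \<in> carrier_mat m n" "Xt \<in> carrier_mat m n" "Q \<in> carrier_mat m n"
      "X \<in> carrier_mat m n" "S \<in> carrier_mat m n"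
    and pos: "\<rho> > 0" "\<delta> \<ge> 0"
    and feas: "feasible m n \<delta> D X S"
    and sub: "\<And>p s'. p \<in> {0..<m} \<times> {0..<n} \<Longrightarrow>
        \<xi> * \<bar>S $$ p\<bar> + \<rho> * (X $$ p - q_mat \<rho> Q Xt $$ p) * (s' - S $$ p) \<le> \<xi> * \<bar>s'\<bar>"
    and normal: "\<And>z'. (\<Sum>p\<in>{0..<m} \<times> {0..<n}. (z' p)\<^sup>2) \<le> \<delta>\<^sup>2 \<Longrightarrow>
        \<kappa> * (\<Sum>p\<in>{0..<m} \<times> {0..<n}. (z' p - (D $$ p - X $$ p - S $$ p))\<^sup>2) \<le>
        - (\<Sum>p\<in>{0..<m} \<times> {0..<n}. \<rho> * (X $$ p - q_mat \<rho> Q Xt $$ p) *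
             (z' p - (D $$ p - X $$ p - S $$ p)))"
    and "\<kappa> > 0"
  shows "optimal_solution m n \<xi> \<rho> \<delta> D Xt Q X' S' \<longleftrightarrow> X' = X \<and> S' = S"
proof -
  let ?I = "{0..<m} \<times> {0..<n}"
  define z where "z X S p = D $$ p - X $$ p - S $$ p" for X S p
  have gap: "objective \<xi> \<rho> Q Xt X S + \<kappa> * (\<Sum>p\<in>?I. (z X' S' p - z X S p)\<^sup>2)
      + \<rho> / 2 * (\<Sum>p\<in>?I. (X' $$ p - X $$ p)\<^sup>2) \<le> objective \<xi> \<rho> Q Xt X' S'"
    if feas': "feasible m n \<delta> D X' S'" for X' S'
  proof -
    have c': "X' \<in> carrier_mat m n" "S' \<in> carrier_mat m n"
      using feas' by (auto simp: feasible_def)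
    let ?g = "\<lambda>p. \<rho> * (X $$ p - q_mat \<rho> Q Xt $$ p)"
    have "(\<Sum>p\<in>?I. (z X' S' p)\<^sup>2) \<le> \<delta>\<^sup>2"
      using feas' feasible_iff[OF carrier(1) c' pos(2)] by (simp add: z_def)
    then have n: "\<kappa> * (\<Sum>p\<in>?I. (z X' S' p - z X S p)\<^sup>2)
        \<le> - (\<Sum>p\<in>?I. ?g p * (z X' S' p - z X S p))"
      using normal[of "z X' S'"] by (simp add: z_def)
    have "(\<Sum>p\<in>?I. (\<xi> * \<bar>S $$ p\<bar> + Q $$ p * (X $$ p - Xt $$ p) + \<rho> / 2 * (X $$ p - Xt $$ p)\<^sup>2)
        - ?g p * (z X' S' p - z X S p) + \<rho> / 2 * (X' $$ p - X $$ p)\<^sup>2) \<le> objective \<xi> \<rho> Q Xt X' S'"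
      unfolding objective_entries[OF carrier(3,2) c'] z_def
      by (intro sum_mono subgradient_gap[OF pos(1) q_mat_entry[OF carrier(3,2)] refl] sub)
    then show ?thesis
      using n unfolding objective_entries[OF carrier(3,2,4,5)] sum.distrib sum_subtractf
      by (simp add: sum_distrib_left)
  qed
  have nonneg: "0 \<le> \<kappa> * (\<Sum>p\<in>?I. (z X' S' p - z X S p)\<^sup>2)" "0 \<le> \<rho> / 2 * (\<Sum>p\<in>?I. (X' $$ p - X $$ p)\<^sup>2)"
    for X' S'
    using pos \<open>\<kappa> > 0\<close> by (auto intro!: mult_nonneg_nonneg sum_nonneg)
  have opt: "optimal_solution m n \<xi> \<rho> \<delta> D Xt Q X S"
    unfolding optimal_solution_def
  proof (intro conjI allI impI)
    fix X' S' assume "feasible m n \<delta> D X' S'"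
    then show "objective \<xi> \<rho> Q Xt X S \<le> objective \<xi> \<rho> Q Xt X' S'"
      using gap[of X' S'] nonneg(1)[of X' S'] nonneg(2)[of X'] by linarith
  qed (rule feas)
  have "X' = X \<and> S' = S" if o: "optimal_solution m n \<xi> \<rho> \<delta> D Xt Q X' S'"
  proof -
    have f: "feasible m n \<delta> D X' S'" and "objective \<xi> \<rho> Q Xt X' S' \<le> objective \<xi> \<rho> Q Xt X S"
      using o feas by (auto simp: optimal_solution_def)
    then have "\<kappa> * (\<Sum>p\<in>?I. (z X' S' p - z X S p)\<^sup>2) = 0" "\<rho> / 2 * (\<Sum>p\<in>?I. (X' $$ p - X $$ p)\<^sup>2) = 0"
      using gap[OF f] nonneg(1)[of X' S'] nonneg(2)[of X'] by linarith+
    then have "(\<Sum>p\<in>?I. (z X' S' p - z X S p)\<^sup>2) = 0" "(\<Sum>p\<in>?I. (X' $$ p - X $$ p)\<^sup>2) = 0"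
      using \<open>\<kappa> > 0\<close> pos by auto
    then have zx: "z X' S' p = z X S p \<and> X' $$ p = X $$ p" if "p \<in> ?I" for p
      using that by (subst (asm) (1 2) sum_nonneg_eq_0_iff) auto
    have c': "X' \<in> carrier_mat m n" "S' \<in> carrier_mat m n"
      using f by (auto simp: feasible_def)
    have "X' $$ p = X $$ p \<and> S' $$ p = S $$ p" if "p \<in> ?I" for p
      using zx[OF that] by (simp add: z_def)
    then show ?thesis
      by (intro conjI mat_eq_entries[OF c'(1) carrier(4)] mat_eq_entries[OF c'(2) carrier(5)]) blast+
  qed
  then show ?thesis
    using opt by blast
qed

lemma optimal_solution_equality_constrained:
  assumes carrier: "D \<in> carrier_mat m n" "Xt \<in> carrier_mat m n" "Q \<in> carrier_mat m n"
    and pos: "\<xi> > 0" "\<rho> > 0"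
  defines "S \<equiv> shrink (D - q_mat \<rho> Q Xt) (\<xi> / \<rho>)"
  shows "optimal_solution m n \<xi> \<rho> 0 D Xt Q X' S' \<longleftrightarrow> X' = D - S \<and> S' = S"
proof -
  let ?I = "{0..<m} \<times> {0..<n}"
  let ?q = "q_mat \<rho> Q Xt"
  have q: "?q \<in> carrier_mat m n" and R: "D - ?q \<in> carrier_mat m n"
    using carrier by (simp_all add: q_mat_carrier minus_carrier_mat)
  have S: "S \<in> carrier_mat m n"
    unfolding S_def by (rule shrink_carrier[OF R])
  have X: "D - S \<in> carrier_mat m n"
    using S by (rule minus_carrier_mat)
  have z: "D $$ p - (D - S) $$ p - S $$ p = 0" if "p \<in> ?I" for p
    using that carrier S by auto
  show ?thesis
  proof (rule optimal_solution_certificate[OF carrier X S pos(2) order_refl, where \<kappa> = 1])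
    show "feasible m n 0 D (D - S) S"
      unfolding feasible_iff[OF carrier(1) X S order_refl] using z by simp
  next
    fix p s' assume p: "p \<in> ?I"
    have "\<rho> * ((D - S) $$ p - ?q $$ p) = \<xi> / (\<xi> / \<rho>) * ((D - ?q) $$ p - S $$ p)"
      using p pos carrier q S by auto
    then show "\<xi> * \<bar>S $$ p\<bar> + \<rho> * ((D - S) $$ p - ?q $$ p) * (s' - S $$ p) \<le> \<xi> * \<bar>s'\<bar>"
      using pos by (intro soft_threshold_subgradient[where c = "\<xi> / \<rho>" and r = "(D - ?q) $$ p"])
        (auto simp: S_def shrink_entry[OF R p])
  next
    fix z' :: "nat \<times> nat \<Rightarrow> real"
    assume "(\<Sum>p\<in>?I. (z' p)\<^sup>2) \<le> 0\<^sup>2"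
    moreover have "0 \<le> (\<Sum>p\<in>?I. (z' p)\<^sup>2)"
      by (simp add: sum_nonneg)
    ultimately have "(\<Sum>p\<in>?I. (z' p)\<^sup>2) = 0"
      by simp
    then have "z' p = 0" if "p \<in> ?I" for p
      using that by (subst (asm) sum_nonneg_eq_0_iff) auto
    then show "1 * (\<Sum>p\<in>?I. (z' p - (D $$ p - (D - S) $$ p - S $$ p))\<^sup>2) \<le>
        - (\<Sum>p\<in>?I. \<rho> * ((D - S) $$ p - ?q $$ p) * (z' p - (D $$ p - (D - S) $$ p - S $$ p)))"
      using z by simp
  qed simp
qed

text \<open>The case of an inactive constraint: \<open>S = 0\<close>, \<open>X = q\<close> minimises both parts of the objective
  separately, so the multiplier vanishes and the certificate above gives no information on the
  slack; positivity of \<open>\<xi>\<close> takes its place.\<close>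

lemma optimal_solution_inactive:
  assumes carrier: "D \<in> carrier_mat m n" "Xt \<in> carrier_mat m n" "Q \<in> carrier_mat m n"
    and pos: "\<xi> > 0" "\<rho> > 0" "\<delta> \<ge> 0"
    and inactive: "fro_norm (D - q_mat \<rho> Q Xt) \<le> \<delta>"
  shows "optimal_solution m n \<xi> \<rho> \<delta> D Xt Q X' S' \<longleftrightarrow> X' = q_mat \<rho> Q Xt \<and> S' = 0\<^sub>m m n"
proof -
  let ?I = "{0..<m} \<times> {0..<n}"
  let ?q = "q_mat \<rho> Q Xt"
  have q: "?q \<in> carrier_mat m n" and R: "D - ?q \<in> carrier_mat m n"
    using carrier by (simp_all add: q_mat_carrier minus_carrier_mat)
  have O: "0\<^sub>m m n \<in> carrier_mat m n"
    by simp
  have gap: "objective \<xi> \<rho> Q Xt ?q (0\<^sub>m m n) + \<xi> * (\<Sum>p\<in>?I. \<bar>S' $$ p\<bar>)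
      + \<rho> / 2 * (\<Sum>p\<in>?I. (X' $$ p - ?q $$ p)\<^sup>2) = objective \<xi> \<rho> Q Xt X' S'"
    if c': "X' \<in> carrier_mat m n" "S' \<in> carrier_mat m n" for X' S'
  proof -
    have "\<xi> * \<bar>0\<^sub>m m n $$ p\<bar> + Q $$ p * (?q $$ p - Xt $$ p) + \<rho> / 2 * (?q $$ p - Xt $$ p)\<^sup>2 +
        \<xi> * \<bar>S' $$ p\<bar> + \<rho> / 2 * (X' $$ p - ?q $$ p)\<^sup>2 =
        \<xi> * \<bar>S' $$ p\<bar> + Q $$ p * (X' $$ p - Xt $$ p) + \<rho> / 2 * (X' $$ p - Xt $$ p)\<^sup>2"
      if p: "p \<in> ?I" for p
    proof -
      have Qp: "Q $$ p = \<rho> * Xt $$ p - \<rho> * ?q $$ p"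
        using pos by (simp add: q_mat_entry[OF carrier(3,2) p] algebra_simps)
      have "0\<^sub>m m n $$ p = (0::real)"
        using p by auto
      then show ?thesis
        unfolding Qp by (simp add: power2_eq_square field_simps)
    qed
    then show ?thesis
      unfolding objective_entries[OF carrier(3,2) c'] objective_entries[OF carrier(3,2) q O]
        sum_distrib_left sum.distrib[symmetric]
      by (intro sum.cong refl)
  qed
  have nonneg: "0 \<le> \<xi> * (\<Sum>p\<in>?I. \<bar>S' $$ p\<bar>)" "0 \<le> \<rho> / 2 * (\<Sum>p\<in>?I. (X' $$ p - ?q $$ p)\<^sup>2)"
    for X' S'
    using pos by (auto intro!: mult_nonneg_nonneg sum_nonneg)
  have "(\<Sum>p\<in>?I. (D $$ p - ?q $$ p - 0\<^sub>m m n $$ p)\<^sup>2) = (\<Sum>p\<in>?I. ((D - ?q) $$ p)\<^sup>2)"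
    using carrier q by (intro sum.cong) auto
  then have feas: "feasible m n \<delta> D ?q (0\<^sub>m m n)"
    using inactive pos unfolding feasible_iff[OF carrier(1) q O pos(3)] fro_norm_le_iff[OF R pos(3)]
    by simp
  have opt: "optimal_solution m n \<xi> \<rho> \<delta> D Xt Q ?q (0\<^sub>m m n)"
    unfolding optimal_solution_def
  proof (intro conjI allI impI)
    fix X' S' assume "feasible m n \<delta> D X' S'"
    then show "objective \<xi> \<rho> Q Xt ?q (0\<^sub>m m n) \<le> objective \<xi> \<rho> Q Xt X' S'"
      using gap[of X' S'] nonneg(1)[of S'] nonneg(2)[of X'] by (simp add: feasible_def)
  qed (rule feas)
  have "X' = ?q \<and> S' = 0\<^sub>m m n" if o: "optimal_solution m n \<xi> \<rho> \<delta> D Xt Q X' S'"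
  proof -
    have c': "X' \<in> carrier_mat m n" "S' \<in> carrier_mat m n"
      and "objective \<xi> \<rho> Q Xt X' S' \<le> objective \<xi> \<rho> Q Xt ?q (0\<^sub>m m n)"
      using o feas by (auto simp: optimal_solution_def feasible_def)
    then have "\<xi> * (\<Sum>p\<in>?I. \<bar>S' $$ p\<bar>) = 0" "\<rho> / 2 * (\<Sum>p\<in>?I. (X' $$ p - ?q $$ p)\<^sup>2) = 0"
      using gap[OF c'] nonneg(1)[of S'] nonneg(2)[of X'] by linarith+
    then have "(\<Sum>p\<in>?I. \<bar>S' $$ p\<bar>) = 0" "(\<Sum>p\<in>?I. (X' $$ p - ?q $$ p)\<^sup>2) = 0"
      using pos by auto
    then have "S' $$ p = 0 \<and> X' $$ p = ?q $$ p" if "p \<in> ?I" for p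
      using that by (subst (asm) (1 2) sum_nonneg_eq_0_iff) auto
    then show ?thesis
      by (auto intro!: mat_eq_entries[OF c'(1) q] mat_eq_entries[OF c'(2) O])
  qed
  then show ?thesis
    using opt by blast
qed

lemma phi_squared:
  "(phi \<xi> \<rho> R \<theta>)\<^sup>2 = (\<Sum>p\<in>indices R. (min (\<xi> / \<theta>) (\<rho> / (\<rho> + \<theta>) * \<bar>R $$ p\<bar>))\<^sup>2)"
  unfolding phi_def fro_norm_squared
  by (intro sum.cong) (auto simp: comp_mat_def ones_mat_def)

text \<open>The active case. The slack of the closed form is entrywise
  \<open>sgn r * min (\<xi> / \<theta>) (\<rho> / (\<rho> + \<theta>) * \<bar>r\<bar>)\<close>, so \<open>phi = \<delta>\<close> puts it on the boundary of the ball, and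
  \<open>\<rho> * (X - q)\<close> is \<open>\<theta>\<close> times the slack, an outer normal there.\<close>

lemma optimal_solution_active:
  assumes carrier: "D \<in> carrier_mat m n" "Xt \<in> carrier_mat m n" "Q \<in> carrier_mat m n"
    and pos: "\<xi> > 0" "\<rho> > 0" "\<delta> \<ge> 0" "\<theta> > 0"
    and active: "phi \<xi> \<rho> (D - q_mat \<rho> Q Xt) \<theta> = \<delta>"
  defines "S \<equiv> shrink (D - q_mat \<rho> Q Xt) (\<xi> * ((\<rho> + \<theta>) / (\<rho> * \<theta>)))"
  defines "X \<equiv> X_star \<rho> D (q_mat \<rho> Q Xt) \<theta> S"
  shows "optimal_solution m n \<xi> \<rho> \<delta> D Xt Q X' S' \<longleftrightarrow> X' = X \<and> S' = S"
proof -
  let ?I = "{0..<m} \<times> {0..<n}"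
  let ?q = "q_mat \<rho> Q Xt"
  let ?R = "D - ?q"
  define c where "c = \<xi> * ((\<rho> + \<theta>) / (\<rho> * \<theta>))"
  have c: "c > 0"
    using pos by (simp add: c_def)
  have c_scaled: "c * (\<rho> * \<theta>) = \<xi> * (\<rho> + \<theta>)"
    using pos by (simp add: c_def)
  have q: "?q \<in> carrier_mat m n" and R: "?R \<in> carrier_mat m n"
    using carrier by (simp_all add: q_mat_carrier minus_carrier_mat)
  have S: "S \<in> carrier_mat m n"
    unfolding S_def by (rule shrink_carrier[OF R])
  have X: "X \<in> carrier_mat m n"
    using carrier S q by (simp add: X_def X_star_def)
  define z where "z p = D $$ p - X $$ p - S $$ p" for p
  have X_entry: "(\<rho> + \<theta>) * X $$ p = \<theta> * (D $$ p - S $$ p) + \<rho> * ?q $$ p"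
    if "p \<in> ?I" for p
  proof -
    have "X $$ p = \<theta> / (\<rho> + \<theta>) * (D $$ p - S $$ p) + \<rho> / (\<rho> + \<theta>) * ?q $$ p"
      using that carrier S q by (auto simp: X_def X_star_def)
    then show ?thesis
      using pos by (simp add: distrib_left)
  qed
  have z_residual: "z p = \<rho> / (\<rho> + \<theta>) * (?R $$ p - S $$ p)" if "p \<in> ?I" for p
  proof -
    have "(\<rho> + \<theta>) * z p = \<rho> * (?R $$ p - S $$ p)"
      using that carrier q X_entry[OF that] by (auto simp: z_def algebra_simps)
    then show ?thesis
      using pos by (simp add: field_simps)
  qed
  have normal: "\<rho> * (X $$ p - ?q $$ p) = \<theta> * z p" if "p \<in> ?I" for p
    using X_entry[OF that] by (simp add: z_def algebra_simps)
  have z_square: "(z p)\<^sup>2 = (min (\<xi> / \<theta>) (\<rho> / (\<rho> + \<theta>) * \<bar>?R $$ p\<bar>))\<^sup>2" if "p \<in> ?I" for p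
  proof -
    have "?R $$ p - S $$ p = sgn (?R $$ p) * min \<bar>?R $$ p\<bar> c"
      using soft_threshold_residual[of c] c by (simp add: S_def shrink_entry[OF R that] c_def)
    then have "\<bar>z p\<bar> = \<rho> / (\<rho> + \<theta>) * min \<bar>?R $$ p\<bar> c"
      using pos c by (auto simp: z_residual[OF that] abs_mult abs_sgn_eq)
    also have "\<dots> = min (\<rho> / (\<rho> + \<theta>) * \<bar>?R $$ p\<bar>) (\<rho> / (\<rho> + \<theta>) * c)"
      using pos by (simp add: min_mult_distrib_left)
    also have "\<rho> / (\<rho> + \<theta>) * c = \<xi> / \<theta>"
      using pos c_scaled by (simp add: field_simps)
    finally show ?thesis
      by (metis min.commute power2_abs)
  qed
  have sum_z: "(\<Sum>p\<in>?I. (z p)\<^sup>2) = \<delta>\<^sup>2"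
    using z_square active phi_squared[of \<xi> \<rho> ?R \<theta>] R by (simp add: carrier_matD[OF q] carrier_matD[OF carrier(1)])
  show ?thesis
  proof (rule optimal_solution_certificate[OF carrier X S pos(2,3), where \<kappa> = "\<theta> / 2"])
    show "feasible m n \<delta> D X S"
      unfolding feasible_iff[OF carrier(1) X S pos(3)] using sum_z by (simp add: z_def)
  next
    fix p s' assume p: "p \<in> ?I"
    have "\<rho> * (X $$ p - ?q $$ p) = \<xi> / c * (?R $$ p - S $$ p)"
    proof -
      have "\<theta> * (\<rho> / (\<rho> + \<theta>)) = \<xi> / c"
        using pos c c_scaled by (simp add: field_simps)
      then show ?thesis
        unfolding normal[OF p] z_residual[OF p] by (metis mult.assoc)
    qed
    then show "\<xi> * \<bar>S $$ p\<bar> + \<rho> * (X $$ p - ?q $$ p) * (s' - S $$ p) \<le> \<xi> * \<bar>s'\<bar>"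
      using pos c by (intro soft_threshold_subgradient[where c = c and r = "?R $$ p"])
        (auto simp: S_def c_def shrink_entry[OF R p])
  next
    fix z' :: "nat \<times> nat \<Rightarrow> real"
    assume z': "(\<Sum>p\<in>?I. (z' p)\<^sup>2) \<le> \<delta>\<^sup>2"
    (* the polarisation identity *)
    have "(\<Sum>p\<in>?I. (z' p - z p)\<^sup>2) + 2 * (\<Sum>p\<in>?I. z p * (z' p - z p))
        = (\<Sum>p\<in>?I. (z' p)\<^sup>2) - (\<Sum>p\<in>?I. (z p)\<^sup>2)"
      by (simp add: sum_distrib_left power2_eq_square algebra_simps flip: sum.distrib sum_subtractf)
    then have "(\<Sum>p\<in>?I. (z' p - z p)\<^sup>2) / 2 \<le> - (\<Sum>p\<in>?I. z p * (z' p - z p))"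
      using z' sum_z by simp
    then have "\<theta> * ((\<Sum>p\<in>?I. (z' p - z p)\<^sup>2) / 2) \<le> \<theta> * - (\<Sum>p\<in>?I. z p * (z' p - z p))"
      using pos by (intro mult_left_mono) auto
    also have "\<dots> = - (\<Sum>p\<in>?I. \<rho> * (X $$ p - ?q $$ p) * (z' p - z p))"
      using normal by (simp add: sum_distrib_left mult.assoc)
    finally show "\<theta> / 2 * (\<Sum>p\<in>?I. (z' p - (D $$ p - X $$ p - S $$ p))\<^sup>2) \<le>
        - (\<Sum>p\<in>?I. \<rho> * (X $$ p - ?q $$ p) * (z' p - (D $$ p - X $$ p - S $$ p)))"
      by (simp add: z_def)
  qed (use pos in simp)
qed

section \<open>The equation for the multiplier\<close>

text \<open>For \<open>V\<close> the squared entries of \<open>R\<close> and \<open>\<theta> > 0\<close> this is \<open>(phi \<xi> \<rho> R \<theta>)\<^sup>2\<close>. A multiset forgets the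
  positions, so that the same function applies to the contents of a heap.\<close>

definition clipped_sum :: "real \<Rightarrow> real \<Rightarrow> real multiset \<Rightarrow> real \<Rightarrow> real" where
  "clipped_sum \<xi> \<rho> V \<theta> = (\<Sum>x\<in>#V. min ((\<xi> / \<theta>)\<^sup>2) ((\<rho> / (\<rho> + \<theta>))\<^sup>2 * x))"

definition squared_entries :: "real mat \<Rightarrow> real multiset" where
  "squared_entries A = {#(A $$ p)\<^sup>2. p \<in># mset_set (indices A)#}"

lemma squared_entries_nonneg: "x \<in># squared_entries A \<Longrightarrow> 0 \<le> x"
  by (auto simp: squared_entries_def)

lemma sum_squared_entries: "sum_mset (squared_entries A) = (fro_norm A)\<^sup>2"
  by (simp add: squared_entries_def fro_norm_squared sum_unfold_sum_mset)

lemma min_power2: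
  fixes a b :: real
  assumes "0 \<le> a" "0 \<le> b"
  shows "(min a b)\<^sup>2 = min (a\<^sup>2) (b\<^sup>2)"
  using assms by (auto simp: min_def abs_le_square_iff[symmetric])

lemma phi_squared_clipped_sum:
  assumes "\<xi> > 0" "\<rho> > 0" "\<theta> > 0"
  shows "(phi \<xi> \<rho> R \<theta>)\<^sup>2 = clipped_sum \<xi> \<rho> (squared_entries R) \<theta>"
  using assms unfolding phi_squared clipped_sum_def squared_entries_def
  by (simp add: sum_unfold_sum_mset multiset.map_comp comp_def min_power2 power_mult_distrib
      del: times_divide_eq_left times_divide_eq_right)

lemma phi_eq_iff:
  assumes "\<xi> > 0" "\<rho> > 0" "\<theta> > 0" "\<delta> \<ge> 0"
  shows "phi \<xi> \<rho> R \<theta> = \<delta> \<longleftrightarrow> clipped_sum \<xi> \<rho> (squared_entries R) \<theta> = \<delta>\<^sup>2"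
  using phi_squared_clipped_sum[OF assms(1-3), of R] assms(4) fro_norm_nonneg
  by (metis phi_def power2_eq_iff_nonneg)

lemma clipped_sum_add_mset:
  "clipped_sum \<xi> \<rho> (add_mset x V) \<theta> =
    min ((\<xi> / \<theta>)\<^sup>2) ((\<rho> / (\<rho> + \<theta>))\<^sup>2 * x) + clipped_sum \<xi> \<rho> V \<theta>"
  by (simp add: clipped_sum_def)

lemma clipped_term_less:
  fixes \<xi> \<rho> x :: real
  assumes "\<xi> > 0" "\<rho> > 0" "0 < \<theta>" "\<theta> < \<theta>'" "x > 0"
  shows "min ((\<xi> / \<theta>')\<^sup>2) ((\<rho> / (\<rho> + \<theta>'))\<^sup>2 * x) < min ((\<xi> / \<theta>)\<^sup>2) ((\<rho> / (\<rho> + \<theta>))\<^sup>2 * x)"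
proof -
  have "(\<xi> / \<theta>')\<^sup>2 < (\<xi> / \<theta>)\<^sup>2" "(\<rho> / (\<rho> + \<theta>'))\<^sup>2 < (\<rho> / (\<rho> + \<theta>))\<^sup>2"
    using assms by (auto intro!: power_strict_mono divide_strict_left_mono)
  then show ?thesis
    using assms by (auto simp: min_less_iff_disj)
qed

lemma clipped_sum_antimono:
  assumes "\<xi> > 0" "\<rho> > 0" "0 < \<theta>" "\<theta> < \<theta>'" "\<And>x. x \<in># V \<Longrightarrow> 0 \<le> x"
  shows "clipped_sum \<xi> \<rho> V \<theta>' \<le> clipped_sum \<xi> \<rho> V \<theta>"
  using assms(5)
proof (induction V)
  case (add x V)
  then show ?case
    using clipped_term_less[OF assms(1-4), of x]
    by (cases "x = 0") (force simp: clipped_sum_add_mset intro!: add_mono)+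
qed (simp add: clipped_sum_def)

lemma clipped_sum_strict_antimono:
  assumes "\<xi> > 0" "\<rho> > 0" "0 < \<theta>" "\<theta> < \<theta>'" "\<And>x. x \<in># V \<Longrightarrow> 0 \<le> x" "clipped_sum \<xi> \<rho> V \<theta>' \<noteq> 0"
  shows "clipped_sum \<xi> \<rho> V \<theta>' < clipped_sum \<xi> \<rho> V \<theta>"
proof -
  have "\<exists>x. x \<in># V \<and> x \<noteq> 0"
  proof (rule ccontr)
    assume "\<not> ?thesis"
    then have "clipped_sum \<xi> \<rho> V \<theta>' = (\<Sum>x\<in>#V. 0)"
      unfolding clipped_sum_def by (intro arg_cong[where f = sum_mset] image_mset_cong) auto
    then show False using assms(6) by simp
  qed
  then obtain x where x: "x \<in># V" "x > 0"
    using assms(5) by force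
  then obtain W where V: "V = add_mset x W"
    by (metis mset_add)
  have "clipped_sum \<xi> \<rho> W \<theta>' \<le> clipped_sum \<xi> \<rho> W \<theta>"
    using assms(5) by (intro clipped_sum_antimono[OF assms(1-4)]) (simp add: V)
  then show ?thesis
    unfolding V clipped_sum_add_mset by (rule add_less_le_mono[OF clipped_term_less[OF assms(1-4) x(2)]])
qed

lemma clipped_sum_root_unique:
  assumes "\<xi> > 0" "\<rho> > 0" "\<And>x. x \<in># V \<Longrightarrow> 0 \<le> x" "c \<noteq> 0"
    and "\<theta> > 0" "clipped_sum \<xi> \<rho> V \<theta> = c" "\<theta>' > 0" "clipped_sum \<xi> \<rho> V \<theta>' = c"
  shows "\<theta> = \<theta>'"
  using clipped_sum_strict_antimono[OF assms(1,2), of \<theta> \<theta>' V]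
    clipped_sum_strict_antimono[OF assms(1,2), of \<theta>' \<theta> V] assms
  by (metis less_irrefl linorder_less_linear)

lemma continuous_on_clipped_sum:
  assumes "\<rho> > 0"
  shows "continuous_on {0<..} (clipped_sum \<xi> \<rho> V)"
proof (induction V)
  case (add x V)
  have "continuous_on {0<..} (\<lambda>\<theta>. min ((\<xi> / \<theta>)\<^sup>2) ((\<rho> / (\<rho> + \<theta>))\<^sup>2 * x))"
    using assms by (intro continuous_intros) auto
  then show ?case
    unfolding clipped_sum_add_mset using add by (intro continuous_on_add)
qed (simp add: clipped_sum_def)

text \<open>As \<open>\<theta>\<close> decreases to \<open>0\<close>, the cap \<open>\<xi> / \<theta>\<close> grows beyond every entry.\<close>

lemma clipped_sum_at_0:
  assumes "\<xi> > 0" "\<rho> > 0"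
  shows "(clipped_sum \<xi> \<rho> V \<longlongrightarrow> sum_mset V) (at_right 0)"
proof (induction V)
  case (add x V)
  have lim: "((\<lambda>\<theta>. (\<rho> / (\<rho> + \<theta>))\<^sup>2 * x) \<longlongrightarrow> (\<rho> / (\<rho> + 0))\<^sup>2 * x) (at_right 0)"
    using assms by (intro tendsto_intros) auto
  have "filterlim (\<lambda>\<theta>. \<xi> / \<theta>) at_top (at_right 0)"
    using filterlim_tendsto_pos_mult_at_top[OF tendsto_const assms(1) filterlim_inverse_at_top_right]
    by (simp add: divide_inverse)
  then have "filterlim (\<lambda>\<theta>. (\<xi> / \<theta>)\<^sup>2) at_top (at_right 0)"
    by (rule filterlim_pow_at_top[rotated]) simp
  then have "eventually (\<lambda>\<theta>. (\<rho> / (\<rho> + 0))\<^sup>2 * x + 1 \<le> (\<xi> / \<theta>)\<^sup>2) (at_right 0)"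
    by (simp add: filterlim_at_top)
  moreover have "eventually (\<lambda>\<theta>. (\<rho> / (\<rho> + \<theta>))\<^sup>2 * x < (\<rho> / (\<rho> + 0))\<^sup>2 * x + 1) (at_right 0)"
    by (rule order_tendstoD(2)[OF lim]) simp
  ultimately have "eventually (\<lambda>\<theta>. (\<rho> / (\<rho> + \<theta>))\<^sup>2 * x =
      min ((\<xi> / \<theta>)\<^sup>2) ((\<rho> / (\<rho> + \<theta>))\<^sup>2 * x)) (at_right 0)"
    by eventually_elim (simp add: min_def)
  then have "((\<lambda>\<theta>. min ((\<xi> / \<theta>)\<^sup>2) ((\<rho> / (\<rho> + \<theta>))\<^sup>2 * x)) \<longlongrightarrow> x) (at_right 0)"
    using Lim_transform_eventually[OF lim] assms by simp
  then show ?case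
    unfolding clipped_sum_add_mset using add by (auto intro!: tendsto_intros)
qed (simp add: clipped_sum_def)

lemma clipped_sum_le: "clipped_sum \<xi> \<rho> V \<theta> \<le> real (size V) * (\<xi> / \<theta>)\<^sup>2"
  by (induction V) (auto simp: clipped_sum_add_mset clipped_sum_def algebra_simps intro!: add_mono)

lemma clipped_sum_le_sum:
  assumes "\<rho> > 0" "\<theta> > 0" "\<And>x. x \<in># V \<Longrightarrow> 0 \<le> x"
  shows "clipped_sum \<xi> \<rho> V \<theta> \<le> sum_mset V"
  using assms(3)
proof (induction V)
  case (add x V)
  have "(\<rho> / (\<rho> + \<theta>))\<^sup>2 \<le> 1"
    using assms by (simp add: power_le_one)
  then have "(\<rho> / (\<rho> + \<theta>))\<^sup>2 * x \<le> x"
    using add.prems[of x] by (simp add: mult_left_le_one_le)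
  then show ?case
    using add by (auto simp: clipped_sum_add_mset intro!: add_mono min.coboundedI2)
qed (simp add: clipped_sum_def)

lemma clipped_sum_root_exists:
  assumes "\<xi> > 0" "\<rho> > 0" "c > 0" "c < sum_mset V"
  shows "\<exists>\<theta>>0. clipped_sum \<xi> \<rho> V \<theta> = c"
proof -
  have "eventually (\<lambda>\<theta>. c < clipped_sum \<xi> \<rho> V \<theta>) (at_right 0)"
    using order_tendstoD(1)[OF clipped_sum_at_0] assms by blast
  then obtain a where a: "a > 0" "c < clipped_sum \<xi> \<rho> V a"
    by (metis eventually_at_right_field dense)
  define b where "b = max a (\<xi> * sqrt (real (size V) / c))"
  have b: "a \<le> b" "b > 0"
    using a by (auto simp: b_def)
  have "\<xi>\<^sup>2 * (real (size V) / c) = (\<xi> * sqrt (real (size V) / c))\<^sup>2"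
    using assms by (simp add: power_mult_distrib)
  also have "\<dots> \<le> b\<^sup>2"
    using assms by (intro power_mono) (auto simp: b_def)
  finally have "real (size V) * (\<xi> / b)\<^sup>2 \<le> c"
    using assms b by (simp add: field_simps power2_eq_square)
  then have "clipped_sum \<xi> \<rho> V b \<le> c"
    using clipped_sum_le order_trans by blast
  moreover have "continuous_on {a..b} (clipped_sum \<xi> \<rho> V)"
    using a by (intro continuous_on_subset[OF continuous_on_clipped_sum[OF assms(2)]]) auto
  ultimately obtain \<theta> where "a \<le> \<theta>" "clipped_sum \<xi> \<rho> V \<theta> = c"
    using IVT2'[of "clipped_sum \<xi> \<rho> V" b c a] a b by auto
  then show ?thesis
    using a by (intro exI[of _ \<theta>]) auto
qed

lemma phi_root_unique:
  assumes "\<xi> > 0" "\<rho> > 0" "\<delta> > 0" "\<not> fro_norm R \<le> \<delta>"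
  shows "\<exists>!\<theta>. \<theta> > 0 \<and> phi \<xi> \<rho> R \<theta> = \<delta>"
proof -
  have "\<delta>\<^sup>2 < sum_mset (squared_entries R)"
    unfolding sum_squared_entries using assms by (intro power_strict_mono) auto
  then obtain \<theta> where \<theta>: "\<theta> > 0" "clipped_sum \<xi> \<rho> (squared_entries R) \<theta> = \<delta>\<^sup>2"
    using clipped_sum_root_exists[OF assms(1,2), of "\<delta>\<^sup>2"] assms(3) by (metis zero_less_power)
  have iff: "phi \<xi> \<rho> R t = \<delta> \<longleftrightarrow> clipped_sum \<xi> \<rho> (squared_entries R) t = \<delta>\<^sup>2" if "t > 0" for t
    using phi_eq_iff[OF assms(1,2) that] assms(3) by simp
  show ?thesis
  proof (rule ex1I[of _ \<theta>])
    show "\<theta> > 0 \<and> phi \<xi> \<rho> R \<theta> = \<delta>"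
      using \<theta> iff by simp
  next
    fix t assume t: "t > 0 \<and> phi \<xi> \<rho> R t = \<delta>"
    then have "clipped_sum \<xi> \<rho> (squared_entries R) t = \<delta>\<^sup>2"
      using iff by blast
    then show "t = \<theta>"
      using clipped_sum_root_unique[OF assms(1,2) squared_entries_nonneg _ _ _ \<theta>] t assms(3) by simp
  qed
qed

text \<open>If \<open>fro_norm R \<le> \<delta>\<close> then \<open>phi = \<delta>\<close> has no positive solution, so the two cases in the
  definition of \<open>theta_star\<close> merge into: the positive solution if there is one, and \<open>0\<close>
  otherwise. An algorithm can therefore decide between them by the search for a solution alone.\<close>

lemma theta_star_eq:
  assumes "\<xi> > 0" "\<rho> > 0" "\<delta> > 0" "\<theta> > 0" "clipped_sum \<xi> \<rho> (squared_entries R) \<theta> = \<delta>\<^sup>2"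
  shows "theta_star \<xi> \<rho> \<delta> R = \<theta>"
proof -
  let ?V = "squared_entries R"
  have "clipped_sum \<xi> \<rho> ?V \<theta> < clipped_sum \<xi> \<rho> ?V (\<theta> / 2)"
    using assms by (intro clipped_sum_strict_antimono squared_entries_nonneg) auto
  also have "\<dots> \<le> sum_mset ?V"
    using assms by (intro clipped_sum_le_sum squared_entries_nonneg) auto
  finally have "\<not> fro_norm R \<le> \<delta>"
    using fro_norm_nonneg[of R] by (simp add: assms sum_squared_entries power_strict_mono abs_le_square_iff)
      (metis power_mono not_le)
  moreover have "phi \<xi> \<rho> R \<theta> = \<delta>"
    using assms by (simp add: phi_eq_iff)
  ultimately show ?thesis
    using phi_root_unique[OF assms(1-3)] assms(4) unfolding theta_star_def
    by (auto intro!: the1_equality)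
qed

lemma theta_star_eq_0:
  assumes "\<xi> > 0" "\<rho> > 0" "\<delta> > 0" "\<And>\<theta>. \<theta> > 0 \<Longrightarrow> clipped_sum \<xi> \<rho> (squared_entries R) \<theta> \<noteq> \<delta>\<^sup>2"
  shows "theta_star \<xi> \<rho> \<delta> R = 0"
proof -
  have "fro_norm R \<le> \<delta>"
    using phi_root_unique[OF assms(1-3), of R] assms by (metis phi_eq_iff less_imp_le)
  then show ?thesis
    by (simp add: theta_star_def)
qed

lemma optimal_solution_closed_form:
  assumes carrier: "D \<in> carrier_mat m n" "Xt \<in> carrier_mat m n" "Q \<in> carrier_mat m n"
    and pos: "\<xi> > 0" "\<rho> > 0" "\<delta> > 0"
  defines "\<theta> \<equiv> theta_star \<xi> \<rho> \<delta> (D - q_mat \<rho> Q Xt)"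
  defines "S \<equiv> S_star \<xi> \<rho> (D - q_mat \<rho> Q Xt) \<theta>"
  shows "optimal_solution m n \<xi> \<rho> \<delta> D Xt Q X' S' \<longleftrightarrow>
    X' = X_star \<rho> D (q_mat \<rho> Q Xt) \<theta> S \<and> S' = S"
proof (cases "fro_norm (D - q_mat \<rho> Q Xt) \<le> \<delta>")
  case True
  have q: "q_mat \<rho> Q Xt \<in> carrier_mat m n"
    using carrier by (simp add: q_mat_carrier)
  have "\<theta> = 0"
    using True by (simp add: \<theta>_def theta_star_def)
  then have "S = 0\<^sub>m m n"
    using q by (simp add: S_def S_star_def)
  moreover have "X_star \<rho> D (q_mat \<rho> Q Xt) \<theta> S = q_mat \<rho> Q Xt"
    unfolding X_star_def \<open>\<theta> = 0\<close> \<open>S = 0\<^sub>m m n\<close>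
    using q carrier pos by (intro eq_matI) auto
  ultimately show ?thesis
    using optimal_solution_inactive[OF carrier pos(1,2) less_imp_le[OF pos(3)] True] by simp
next
  case False
  then have "\<theta> > 0" "phi \<xi> \<rho> (D - q_mat \<rho> Q Xt) \<theta> = \<delta>"
    using theI'[OF phi_root_unique[OF pos False]] by (simp_all add: \<theta>_def theta_star_def)
  then show ?thesis
    using optimal_solution_active[OF carrier pos(1,2) less_imp_le[OF pos(3)], of \<theta> X' S']
    by (simp add: S_def S_star_def)
qed

text \<open>Multiplied by \<open>\<rho>\<^sup>2 * \<theta>\<^sup>2\<close>, the squared threshold \<open>(\<xi> * (\<rho> + \<theta>) / (\<rho> * \<theta>))\<^sup>2\<close> becomes a polynomial;
  the minimum is its first argument for squares above the threshold and its second below.\<close>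

lemma clipped_sum_partition:
  assumes "\<xi> > 0" "\<rho> > 0" "\<theta> > 0"
    and "\<And>x. x \<in># P \<Longrightarrow> \<xi>\<^sup>2 * (\<rho> + \<theta>)\<^sup>2 \<le> x * (\<rho>\<^sup>2 * \<theta>\<^sup>2)"
    and "\<And>x. x \<in># M \<Longrightarrow> x * (\<rho>\<^sup>2 * \<theta>\<^sup>2) \<le> \<xi>\<^sup>2 * (\<rho> + \<theta>)\<^sup>2"
  shows "clipped_sum \<xi> \<rho> (P + M) \<theta> = real (size P) * (\<xi> / \<theta>)\<^sup>2 + (\<rho> / (\<rho> + \<theta>))\<^sup>2 * sum_mset M"
proof -
  have c: "(\<xi> / \<theta>)\<^sup>2 \<le> (\<rho> / (\<rho> + \<theta>))\<^sup>2 * x \<longleftrightarrow> \<xi>\<^sup>2 * (\<rho> + \<theta>)\<^sup>2 \<le> x * (\<rho>\<^sup>2 * \<theta>\<^sup>2)"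
    "(\<rho> / (\<rho> + \<theta>))\<^sup>2 * x \<le> (\<xi> / \<theta>)\<^sup>2 \<longleftrightarrow> x * (\<rho>\<^sup>2 * \<theta>\<^sup>2) \<le> \<xi>\<^sup>2 * (\<rho> + \<theta>)\<^sup>2" for x
    using assms by (simp_all add: power_divide divide_le_eq le_divide_eq mult.commute mult.left_commute)
  have "clipped_sum \<xi> \<rho> P \<theta> = (\<Sum>x\<in>#P. (\<xi> / \<theta>)\<^sup>2)"
    unfolding clipped_sum_def using assms(4)
    by (intro arg_cong[where f = sum_mset] image_mset_cong) (simp add: min_absorb1 c)
  moreover have "clipped_sum \<xi> \<rho> M \<theta> = (\<Sum>x\<in>#M. (\<rho> / (\<rho> + \<theta>))\<^sup>2 * x)"
    unfolding clipped_sum_def using assms(5)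
    by (intro arg_cong[where f = sum_mset] image_mset_cong) (simp add: min_absorb2 c)
  moreover have "clipped_sum \<xi> \<rho> (P + M) \<theta> = clipped_sum \<xi> \<rho> P \<theta> + clipped_sum \<xi> \<rho> M \<theta>"
    by (simp add: clipped_sum_def)
  ultimately show ?thesis
    by (simp add: sum_mset_distrib_left)
qed

lemma clipped_sum_add_zeros: "clipped_sum \<xi> \<rho> (V + replicate_mset z 0) \<theta> = clipped_sum \<xi> \<rho> V \<theta>"
  by (simp add: clipped_sum_def)

lemma quartic_equation_iff:
  fixes \<theta> :: real
  assumes "\<rho> > 0" "\<theta> > 0"
  shows "K * (\<xi> / \<theta>)\<^sup>2 + (\<rho> / (\<rho> + \<theta>))\<^sup>2 * B = \<delta>\<^sup>2 \<longleftrightarrow>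
    \<delta>\<^sup>2 * \<theta> ^ 4 + 2 * \<delta>\<^sup>2 * \<rho> * \<theta> ^ 3 + (\<delta>\<^sup>2 * \<rho>\<^sup>2 - K * \<xi>\<^sup>2 - \<rho>\<^sup>2 * B) * \<theta>\<^sup>2
      + (- 2 * K * \<xi>\<^sup>2 * \<rho>) * \<theta> + (- K * \<xi>\<^sup>2 * \<rho>\<^sup>2) = 0"
proof -
  have "\<rho> + \<theta> \<noteq> 0" "\<theta> \<noteq> 0" using assms by auto
  then have "K * (\<xi> / \<theta>)\<^sup>2 + (\<rho> / (\<rho> + \<theta>))\<^sup>2 * B = \<delta>\<^sup>2 \<longleftrightarrow>
    K * \<xi>\<^sup>2 * (\<rho> + \<theta>)\<^sup>2 + \<rho>\<^sup>2 * B * \<theta>\<^sup>2 = \<delta>\<^sup>2 * (\<theta>\<^sup>2 * (\<rho> + \<theta>)\<^sup>2)"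
    by (simp add: power_divide add_frac_eq divide_eq_eq mult_ac)
  also have "\<dots> \<longleftrightarrow> \<delta>\<^sup>2 * (\<theta>\<^sup>2 * (\<rho> + \<theta>)\<^sup>2) - (K * \<xi>\<^sup>2 * (\<rho> + \<theta>)\<^sup>2 + \<rho>\<^sup>2 * B * \<theta>\<^sup>2) = 0"
    by auto
  also have "\<delta>\<^sup>2 * (\<theta>\<^sup>2 * (\<rho> + \<theta>)\<^sup>2) - (K * \<xi>\<^sup>2 * (\<rho> + \<theta>)\<^sup>2 + \<rho>\<^sup>2 * B * \<theta>\<^sup>2) =
    \<delta>\<^sup>2 * \<theta> ^ 4 + 2 * \<delta>\<^sup>2 * \<rho> * \<theta> ^ 3 + (\<delta>\<^sup>2 * \<rho>\<^sup>2 - K * \<xi>\<^sup>2 - \<rho>\<^sup>2 * B) * \<theta>\<^sup>2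
      + (- 2 * K * \<xi>\<^sup>2 * \<rho>) * \<theta> + (- K * \<xi>\<^sup>2 * \<rho>\<^sup>2)"
    by (simp add: power2_eq_square power3_eq_cube power4_eq_xxxx algebra_simps)
  finally show ?thesis .
qed

text \<open>For nonnegative \<open>K\<close> and \<open>B\<close> the left-hand side of the equation decreases strictly in
  \<open>\<theta> > 0\<close>. So the quartic has at most one positive root, and such a root is its largest one,
  the last in the list that the quartic primitive returns.\<close>

lemma quartic_equation_root_unique:
  fixes \<theta> \<theta>' :: real
  assumes "\<rho> > 0" "\<delta> > 0" "K \<ge> 0" "B \<ge> 0" "\<theta> > 0" "\<theta>' > 0"
    and "K * (\<xi> / \<theta>)\<^sup>2 + (\<rho> / (\<rho> + \<theta>))\<^sup>2 * B = \<delta>\<^sup>2" "K * (\<xi> / \<theta>')\<^sup>2 + (\<rho> / (\<rho> + \<theta>'))\<^sup>2 * B = \<delta>\<^sup>2"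
  shows "\<theta> = \<theta>'"
proof -
  have less: False
    if "0 < a" "a < b" "K * (\<xi> / a)\<^sup>2 + (\<rho> / (\<rho> + a))\<^sup>2 * B = \<delta>\<^sup>2"
      "K * (\<xi> / b)\<^sup>2 + (\<rho> / (\<rho> + b))\<^sup>2 * B = \<delta>\<^sup>2" for a b
  proof -
    have r: "(\<rho> / (\<rho> + b))\<^sup>2 < (\<rho> / (\<rho> + a))\<^sup>2"
      using assms that by (intro power_strict_mono divide_strict_left_mono) auto
    have x: "(1 / b)\<^sup>2 < (1 / a)\<^sup>2"
      using that by (intro power_strict_mono divide_strict_left_mono) auto
    have e: "K * (\<xi> / t)\<^sup>2 = K * \<xi>\<^sup>2 * (1 / t)\<^sup>2" for t
      by (simp add: power_divide)
    have K: "K * \<xi>\<^sup>2 \<ge> 0"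
      using assms by simp
    have le: "K * \<xi>\<^sup>2 * (1 / b)\<^sup>2 \<le> K * \<xi>\<^sup>2 * (1 / a)\<^sup>2"
      "(\<rho> / (\<rho> + b))\<^sup>2 * B \<le> (\<rho> / (\<rho> + a))\<^sup>2 * B"
      using K assms(4) r x by (intro mult_left_mono mult_right_mono; simp)+
    have "\<not> (K * \<xi>\<^sup>2 = 0 \<and> B = 0)"
      using that assms(2) by (auto simp: e)
    then have "K * \<xi>\<^sup>2 > 0 \<or> B > 0"
      using K assms(4) by (metis order_le_less)
    then have "K * \<xi>\<^sup>2 * (1 / b)\<^sup>2 + (\<rho> / (\<rho> + b))\<^sup>2 * B < K * \<xi>\<^sup>2 * (1 / a)\<^sup>2 + (\<rho> / (\<rho> + a))\<^sup>2 * B"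
    proof
      assume "K * \<xi>\<^sup>2 > 0"
      then show ?thesis
        using x le by (intro add_less_le_mono mult_strict_left_mono)
    next
      assume "B > 0"
      then show ?thesis
        using r le by (intro add_le_less_mono mult_strict_right_mono)
    qed
    then show False
      using that by (simp add: e)
  qed
  show ?thesis
    using less[of \<theta> \<theta>'] less[of \<theta>' \<theta>] assms by (metis linorder_less_linear)
qed

lemma finite_quartic_root_set:
  fixes c4 :: real
  assumes "c4 \<noteq> 0"
  shows "finite {x. c4 * x ^ 4 + c3 * x ^ 3 + c2 * x\<^sup>2 + c1 * x + c0 = 0}"
proof -
  let ?p = "[:c0, c1, c2, c3, c4:]"
  have "{x. c4 * x ^ 4 + c3 * x ^ 3 + c2 * x\<^sup>2 + c1 * x + c0 = 0} = {x. poly ?p x = 0}"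
    by (auto simp: algebra_simps power2_eq_square power3_eq_cube power4_eq_xxxx)
  then show ?thesis
    using poly_roots_finite[of ?p] assms by simp
qed

lemma last_quartic_root:
  assumes "\<rho> > 0" "\<delta> > 0" "K \<ge> 0" "B \<ge> 0" "\<theta> > 0" "K * (\<xi> / \<theta>)\<^sup>2 + (\<rho> / (\<rho> + \<theta>))\<^sup>2 * B = \<delta>\<^sup>2"
  defines "rs \<equiv> quartic_roots (\<delta>\<^sup>2) (2 * \<delta>\<^sup>2 * \<rho>) (\<delta>\<^sup>2 * \<rho>\<^sup>2 - K * \<xi>\<^sup>2 - \<rho>\<^sup>2 * B)
    (- 2 * K * \<xi>\<^sup>2 * \<rho>) (- K * \<xi>\<^sup>2 * \<rho>\<^sup>2)"
  shows "rs \<noteq> [] \<and> rs ! (length rs - 1) = \<theta>"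
proof -
  define Z where "Z = {x. \<delta>\<^sup>2 * x ^ 4 + 2 * \<delta>\<^sup>2 * \<rho> * x ^ 3 + (\<delta>\<^sup>2 * \<rho>\<^sup>2 - K * \<xi>\<^sup>2 - \<rho>\<^sup>2 * B) * x\<^sup>2
      + (- 2 * K * \<xi>\<^sup>2 * \<rho>) * x + (- K * \<xi>\<^sup>2 * \<rho>\<^sup>2) = 0}"
  have fin: "finite Z"
    unfolding Z_def using assms by (intro finite_quartic_root_set) simp
  have rs: "rs = sorted_list_of_set Z"
    using assms(2) by (simp add: rs_def quartic_roots_def Z_def)
  have mem: "x \<in> Z \<longleftrightarrow> K * (\<xi> / x)\<^sup>2 + (\<rho> / (\<rho> + x))\<^sup>2 * B = \<delta>\<^sup>2" if "x > 0" for x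
    unfolding Z_def mem_Collect_eq quartic_equation_iff[OF assms(1) that] ..
  have \<theta>: "\<theta> \<in> Z"
    using assms mem by blast
  then have ne: "rs \<noteq> []"
    using fin by (auto simp: rs)
  have set: "set rs = Z" and sorted: "sorted rs"
    using fin by (simp_all add: rs)
  obtain i where "i < length rs" "\<theta> = rs ! i"
    using \<theta> set by (metis in_set_conv_nth)
  then have "\<theta> \<le> last rs"
    using sorted_nth_mono[OF sorted, of i "length rs - 1"] by (simp add: last_conv_nth ne)
  moreover have "last rs \<in> Z"
    using ne set last_in_set by blast
  ultimately have last: "last rs > 0" "K * (\<xi> / last rs)\<^sup>2 + (\<rho> / (\<rho> + last rs))\<^sup>2 * B = \<delta>\<^sup>2"
    using mem[of "last rs"] assms(5) by auto
  have "last rs = \<theta>"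
    by (rule quartic_equation_root_unique[OF assms(1-4) last(1) assms(5) last(2) assms(6)])
  then show ?thesis
    using ne by (simp add: last_conv_nth)
qed

section \<open>Timed execution\<close>

definition runs_within :: "com \<Rightarrow> store \<Rightarrow> nat \<Rightarrow> (store \<Rightarrow> bool) \<Rightarrow> bool" where
  "runs_within c s B Q \<longleftrightarrow> (\<exists>t s'. exec c s t s' \<and> t \<le> B \<and> Q s')"

lemma runs_within_mono: "runs_within c s B Q \<Longrightarrow> B \<le> B' \<Longrightarrow> (\<And>s'. Q s' \<Longrightarrow> Q' s') \<Longrightarrow> runs_within c s B' Q'"
  unfolding runs_within_def by (meson order_trans)

lemma runs_within_Seq:
  assumes "runs_within c s B Q" "\<And>s'. Q s' \<Longrightarrow> runs_within d s' B' Q'"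
  shows "runs_within (Seq c d) s (B + B') Q'"
proof -
  obtain t s' where c: "exec c s t s'" "t \<le> B" "Q s'"
    using assms(1) by (auto simp: runs_within_def)
  obtain t' s'' where d: "exec d s' t' s''" "t' \<le> B'" "Q' s''"
    using assms(2)[OF c(3)] by (auto simp: runs_within_def)
  show ?thesis
    unfolding runs_within_def using exec_Seq[OF c(1) d(1)] c d by (meson add_mono)
qed

text \<open>The index \<open>k\<close> of the invariant bounds the number of remaining iterations.\<close>

lemma runs_within_While:
  assumes "I k s" "\<And>k s. I k s \<Longrightarrow> bval b s \<Longrightarrow> \<exists>j. k = Suc j \<and> runs_within c s B (I j)"
  shows "runs_within (While b c) s (k * (bcost b + B + 1) + bcost b + 1)
    (\<lambda>s'. (\<exists>j. I j s') \<and> \<not> bval b s')"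
  using assms(1)
proof (induction k arbitrary: s rule: less_induct)
  case (less k)
  show ?case
  proof (cases "bval b s")
    case True
    then obtain j where j: "k = Suc j" "runs_within c s B (I j)"
      using assms(2) less.prems by blast
    then obtain t s' where c: "exec c s t s'" "t \<le> B" "I j s'"
      by (auto simp: runs_within_def)
    obtain t' s'' where w: "exec (While b c) s' t' s''" "t' \<le> j * (bcost b + B + 1) + bcost b + 1"
      "\<exists>j. I j s''" "\<not> bval b s''"
      using less.IH[OF _ c(3)] j(1) by (auto simp: runs_within_def)
    have "bcost b + t + t' + 1 \<le> k * (bcost b + B + 1) + bcost b + 1"
      using c(2) w(2) by (simp add: j(1))
    then show ?thesis
      unfolding runs_within_def using exec_WhileTrue[OF True c(1) w(1)] w(3,4) by blast
  next
    case False
    then show ?thesis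
      unfolding runs_within_def using exec_WhileFalse[OF False] less.prems
      by (intro exI[of _ "bcost b + 1"] exI[of _ s]) auto
  qed
qed

text \<open>The effect and a cost bound of loop-free code are found by rewriting, so that invariants are
  required for loops only.\<close>

primrec loop_free :: "com \<Rightarrow> bool" where
  "loop_free Skip \<longleftrightarrow> True"
| "loop_free (ISet x a) \<longleftrightarrow> True"
| "loop_free (RSet x i a) \<longleftrightarrow> True"
| "loop_free (Quartic x l a4 a3 a2 a1 a0) \<longleftrightarrow> True"
| "loop_free (Seq c d) \<longleftrightarrow> loop_free c \<and> loop_free d"
| "loop_free (Cond b c d) \<longleftrightarrow> loop_free c \<and> loop_free d"
| "loop_free (While b c) \<longleftrightarrow> False"

text \<open>The clauses for loops in \<open>run\<close> and \<open>max_cost\<close> carry no meaning.\<close>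

primrec run :: "com \<Rightarrow> store \<Rightarrow> store" where
  "run Skip s = s"
| "run (ISet x a) s = set_index x (ival a s) s"
| "run (RSet x i a) s = set_cell x (ival i s) (rval a s) s"
| "run (Quartic x l a4 a3 a2 a1 a0) s = store_list x l
     (quartic_roots (rval a4 s) (rval a3 s) (rval a2 s) (rval a1 s) (rval a0 s)) s"
| "run (Seq c d) s = run d (run c s)"
| "run (Cond b c d) s = (if bval b s then run c s else run d s)"
| "run (While b c) s = s"

primrec max_cost :: "com \<Rightarrow> nat" where
  "max_cost Skip = 1"
| "max_cost (ISet x a) = icost a + 1"
| "max_cost (RSet x i a) = icost i + rcost a + 1"
| "max_cost (Quartic x l a4 a3 a2 a1 a0) =
     rcost a4 + rcost a3 + rcost a2 + rcost a1 + rcost a0 + 1"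
| "max_cost (Seq c d) = max_cost c + max_cost d"
| "max_cost (Cond b c d) = bcost b + max (max_cost c) (max_cost d) + 1"
| "max_cost (While b c) = 0"

lemma exec_loop_free: "loop_free c \<Longrightarrow> \<exists>t\<le>max_cost c. exec c s t (run c s)"
proof (induction c arbitrary: s)
  case (Seq c d)
  then obtain t t' where "t \<le> max_cost c" "exec c s t (run c s)"
    "t' \<le> max_cost d" "exec d (run c s) t' (run d (run c s))"
    by (metis loop_free.simps(5))
  then show ?case
    by (auto intro!: exI[of _ "t + t'"] exec_Seq add_mono)
next
  case (Cond b c d)
  then obtain t t' where *: "t \<le> max_cost c" "exec c s t (run c s)"
    "t' \<le> max_cost d" "exec d s t' (run d s)"
    by (metis loop_free.simps(6))
  show ?case
  proof (cases "bval b s")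
    case True
    then show ?thesis
      using * exec_CondTrue[OF True *(2), of d] by (intro exI[of _ "bcost b + t + 1"]) auto
  next
    case False
    then show ?thesis
      using * exec_CondFalse[OF False *(4), of c] by (intro exI[of _ "bcost b + t' + 1"]) auto
  qed
next
  case Skip
  show ?case using exec_Skip[of s] by auto
next
  case (ISet x a)
  show ?case using exec_ISet[of x a s] by (metis run.simps(2) max_cost.simps(2) order_refl)
next
  case (RSet x i a)
  show ?case using exec_RSet[of x i a s] by (metis run.simps(3) max_cost.simps(3) order_refl)
next
  case (Quartic x l a4 a3 a2 a1 a0)
  show ?case
    using exec_Quartic[of x l a4 a3 a2 a1 a0 s] by (metis run.simps(4) max_cost.simps(4) order_refl)
qed simp

lemma runs_within_loop_free: "loop_free c \<Longrightarrow> Q (run c s) \<Longrightarrow> runs_within c s (max_cost c) Q"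
  unfolding runs_within_def using exec_loop_free by blast

lemma store_update_simps [simp]:
  "fst (set_index x k s) = (fst s)(x := k)" "snd (set_index x k s) = snd s"
  "fst (set_cell x i r s) = fst s" "snd (set_cell x i r s) = (snd s)(x := (snd s x)(i := r))"
  by (simp_all add: set_index_def set_cell_def)

section \<open>Heaps with a moving hole\<close>

text \<open>Nodes are numbered from \<open>1\<close>, the children of \<open>x\<close> being \<open>2 * x\<close> and \<open>2 * x + 1\<close>; nodes
  \<open>1..<N\<close> are internal and \<open>N..<2 * N\<close> are leaves. Index expressions can double but not halve a
  number, so the heap is only ever traversed downwards: the input is placed on the leaves, and a
  hole at an internal node is moved down to a leaf, the larger child being promoted at each step.
  The same operation builds the heap, with the initial internal nodes as holes, and removes
  the maximum. Since the values are nonnegative, \<open>0\<close> marks an empty node.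

  In \<open>heap_from N r\<close> only the nodes from \<open>r\<close> on are in order, as during the construction from
  the last internal node to the root.\<close>

definition heap_from :: "nat \<Rightarrow> nat \<Rightarrow> (nat \<Rightarrow> real) \<Rightarrow> bool" where
  "heap_from N r T \<longleftrightarrow> (\<forall>x. 0 \<le> T x) \<and> (\<forall>x\<ge>r. x < N \<longrightarrow> T (2 * x) \<le> T x \<and> T (2 * x + 1) \<le> T x)"

text \<open>The state of a heap while the hole \<open>i\<close> moves down: the parent of the hole already
  dominates the children of the hole.\<close>

definition heap_with_hole :: "nat \<Rightarrow> nat \<Rightarrow> nat \<Rightarrow> (nat \<Rightarrow> real) \<Rightarrow> bool" where
  "heap_with_hole N r i T \<longleftrightarrow> (\<forall>x. 0 \<le> T x) \<and>
     (\<forall>x\<ge>r. x < N \<longrightarrow> x \<noteq> i \<longrightarrow> T (2 * x) \<le> T x \<and> T (2 * x + 1) \<le> T x) \<and>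
     (\<forall>x\<ge>r. i < N \<longrightarrow> 2 * x = i \<or> 2 * x + 1 = i \<longrightarrow> T (2 * i) \<le> T x \<and> T (2 * i + 1) \<le> T x)"

definition node_values :: "nat \<Rightarrow> (nat \<Rightarrow> real) \<Rightarrow> real multiset" where
  "node_values N T = {#T x. x \<in># mset_set {1..<2 * N}#}"

definition larger_child :: "(nat \<Rightarrow> real) \<Rightarrow> nat \<Rightarrow> nat" where
  "larger_child T i = (if T (2 * i) < T (2 * i + 1) then 2 * i + 1 else 2 * i)"

lemma heap_with_hole_start:
  "heap_from N (Suc r) T \<Longrightarrow> 1 \<le> r \<Longrightarrow> heap_with_hole N r r T"
  by (auto simp: heap_from_def heap_with_hole_def)

lemma heap_with_hole_step:
  assumes "heap_with_hole N r i T" "1 \<le> i" "r \<le> i" "i < N"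
  shows "heap_with_hole N r (larger_child T i) (T(i := T (larger_child T i)))"
proof -
  define j where "j = larger_child T i"
  have j: "j = 2 * i \<or> j = 2 * i + 1" "T (2 * i) \<le> T j" "T (2 * i + 1) \<le> T j" "r \<le> j" "j \<noteq> i"
    using assms by (auto simp: j_def larger_child_def)
  have h: "T (2 * x) \<le> T x" "T (2 * x + 1) \<le> T x" if "r \<le> x" "x < N" "x \<noteq> i" for x
    using assms(1) that by (auto simp: heap_with_hole_def)
  have p: "T j \<le> T x" if "r \<le> x" "2 * x = i \<or> 2 * x + 1 = i" for x
    using assms(1,4) that j(1) by (auto simp: heap_with_hole_def)
  have odd: "2 * x + 1 = 2 * y \<longleftrightarrow> False" "2 * y = 2 * x + 1 \<longleftrightarrow> False" for x y :: nat
    by presburger+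
  have "0 \<le> T x" for x
    using assms(1) by (simp add: heap_with_hole_def)
  moreover have "(T(i := T j)) (2 * x) \<le> (T(i := T j)) x \<and> (T(i := T j)) (2 * x + 1) \<le> (T(i := T j)) x"
    if "r \<le> x" "x < N" "x \<noteq> j" for x
    using j h[OF that(1,2)] p[OF that(1)] assms(2) by (cases "x = i") auto
  moreover have "(T(i := T j)) (2 * j) \<le> (T(i := T j)) x \<and> (T(i := T j)) (2 * j + 1) \<le> (T(i := T j)) x"
    if "r \<le> x" "j < N" "2 * x = j \<or> 2 * x + 1 = j" for x
  proof -
    have "x = i"
      using that(3) j(1) by presburger
    then show ?thesis
      using h[OF j(4) that(2) j(5)] j(1) assms(2) by auto
  qed
  ultimately show ?thesis
    by (simp add: heap_with_hole_def j_def[symmetric])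
qed

lemma heap_with_hole_end:
  "heap_with_hole N r i T \<Longrightarrow> N \<le> i \<Longrightarrow> heap_from N r (T(i := 0))"
  by (auto simp: heap_with_hole_def heap_from_def)

lemma node_values_update:
  assumes "1 \<le> i" "i < 2 * N"
  shows "node_values N (T(i := v)) = add_mset v {#T x. x \<in># mset_set ({1..<2 * N} - {i})#}"
proof -
  have "mset_set {1..<2 * N} = add_mset i (mset_set ({1..<2 * N} - {i}))"
    using assms by (intro mset_set.remove) auto
  moreover have "{#(T(i := v)) x. x \<in># mset_set ({1..<2 * N} - {i})#} = {#T x. x \<in># mset_set ({1..<2 * N} - {i})#}"
    by (intro image_mset_cong) auto
  ultimately show ?thesis
    by (simp add: node_values_def del: fun_upd_apply) simp
qed

lemma node_values_remove:
  assumes "1 \<le> i" "i < 2 * N"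
  shows "add_mset (T i) (node_values N (T(i := 0))) = add_mset 0 (node_values N T)"
  using node_values_update[OF assms, of T 0] node_values_update[OF assms, of T "T i"] by simp

text \<open>Moving the hole only exchanges the contents of two nodes.\<close>

lemma node_values_move_hole:
  assumes "1 \<le> i" "i < 2 * N" "1 \<le> j" "j < 2 * N" "i \<noteq> j"
  shows "node_values N (T(i := T j, j := 0)) = node_values N (T(i := 0))"
proof -
  have "add_mset (T j) (node_values N (T(i := T j, j := 0))) = add_mset 0 (node_values N (T(i := T j)))"
    using node_values_remove[OF assms(3,4), of "T(i := T j)"] assms by simp
  also have "\<dots> = add_mset (T j) (node_values N (T(i := 0)))"
    by (simp add: node_values_update[OF assms(1,2)] add_mset_commute)
  finally show ?thesis
    by simp
qed

lemma heap_root_max: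
  assumes "heap_from N 1 T" "1 \<le> x" "x < 2 * N"
  shows "T x \<le> T 1"
  using assms(2,3)
proof (induction x rule: less_induct)
  case (less x)
  show ?case
  proof (cases "x = 1")
    case False
    define y where "y = x div 2"
    have y: "1 \<le> y" "y < x" "y < N" "x = 2 * y \<or> x = 2 * y + 1"
      using less.prems False unfolding y_def by presburger+
    then have "T x \<le> T y"
      using assms(1) by (auto simp: heap_from_def)
    then show ?thesis
      using less.IH[of y] y less.prems by simp
  qed simp
qed

subsection \<open>Filling the hole\<close>

definition pull_step :: com where
  "pull_step =
     Seq (Cond (RLess (RCell ''h'' (IMul (INum 2) (IVar ''i'')))
                      (RCell ''h'' (IAdd (IMul (INum 2) (IVar ''i'')) (INum 1))))
            (ISet ''j'' (IAdd (IMul (INum 2) (IVar ''i'')) (INum 1)))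
            (ISet ''j'' (IMul (INum 2) (IVar ''i''))))
    (Seq (RSet ''h'' (IVar ''i'') (RCell ''h'' (IVar ''j'')))
         (ISet ''i'' (IVar ''j'')))"

definition pull :: com where
  "pull = Seq (While (ILess (IVar ''i'') (IVar ''N'')) pull_step) (RSet ''h'' (IVar ''i'') (RNum 0))"

definition pull_cost :: "nat \<Rightarrow> nat" where
  "pull_cost d = d * (4 + max_cost pull_step) + 7"

definition heap_frame :: "store \<Rightarrow> store \<Rightarrow> bool" where
  "heap_frame s s' \<longleftrightarrow> (\<forall>x. x \<noteq> ''i'' \<longrightarrow> x \<noteq> ''j'' \<longrightarrow> fst s' x = fst s x) \<and>
     (\<forall>x. x \<noteq> ''h'' \<longrightarrow> snd s' x = snd s x)"

text \<open>The number of the hole at least doubles in each step; \<open>N \<le> i * 2 ^ d\<close> bounds the remaining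
  steps by \<open>d\<close>. The invariant compares the contents with the hole emptied, on both sides, because
  the value at the hole is out of date once it has been promoted.\<close>

lemma runs_within_pull:
  assumes r: "fst s ''i'' = r" "1 \<le> r" "r < 2 * N" and N: "fst s ''N'' = N" "N \<le> 2 ^ d"
    and heap: "heap_from N (Suc r) (snd s ''h'')"
  shows "runs_within pull s (pull_cost d) (\<lambda>s'. heap_frame s s' \<and> heap_from N r (snd s' ''h'') \<and>
    (\<forall>x<r. snd s' ''h'' x = snd s ''h'' x) \<and> node_values N (snd s' ''h'') = node_values N ((snd s ''h'')(r := 0)))"
proof -
  define I where "I d s' \<longleftrightarrow> heap_frame s s' \<and> r \<le> fst s' ''i'' \<and> fst s' ''i'' < 2 * N \<and>
      N \<le> fst s' ''i'' * 2 ^ d \<and> heap_with_hole N r (fst s' ''i'') (snd s' ''h'') \<and>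
      (\<forall>x<r. snd s' ''h'' x = snd s ''h'' x) \<and>
      node_values N ((snd s' ''h'')(fst s' ''i'' := 0)) = node_values N ((snd s ''h'')(r := 0))"
    for d s'
  have start: "I d s"
    using r N heap heap_with_hole_start[OF heap r(2)]
    by (simp add: I_def heap_frame_def order_trans[OF N(2)])
  have "\<exists>j. k = Suc j \<and> runs_within pull_step s' (max_cost pull_step) (I j)"
    if inv: "I k s'" and guard: "bval (ILess (IVar ''i'') (IVar ''N'')) s'" for k s'
  proof -
    define i where "i = fst s' ''i''"
    define T where "T = snd s' ''h''"
    define c where "c = larger_child T i"
    have iN: "i < N" "1 \<le> i" "r \<le> i"
      using guard inv N r by (auto simp: I_def heap_frame_def i_def)
    then obtain j where j: "k = Suc j"
      using inv by (cases k) (auto simp: I_def i_def)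
    have c: "2 * i \<le> c" "c < 2 * N"
      using iN by (auto simp: c_def larger_child_def)
    have "N \<le> 2 * i * 2 ^ j"
      using inv j by (simp add: I_def i_def mult_ac)
    also have "\<dots> \<le> c * 2 ^ j"
      using c by simp
    finally have "N \<le> c * 2 ^ j" .
    moreover have "node_values N (T(i := T c, c := 0)) = node_values N ((snd s ''h'')(r := 0))"
      using node_values_move_hole[of i N c T] iN c inv by (simp add: I_def i_def T_def)
    moreover have "heap_with_hole N r c (T(i := T c))"
      using heap_with_hole_step[OF _ iN(2,3,1)] inv by (simp add: I_def i_def T_def c_def)
    moreover have "\<forall>x<r. T x = snd s ''h'' x"
      using inv by (simp add: I_def T_def)
    then have "\<forall>x<r. (T(i := T c)) x = snd s ''h'' x"
      using iN(3) by auto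
    moreover have "fst (run pull_step s') ''i'' = c" "snd (run pull_step s') ''h'' = T(i := T c)"
      "heap_frame s' (run pull_step s')"
      by (auto simp: pull_step_def larger_child_def heap_frame_def i_def T_def c_def)
    ultimately have "I j (run pull_step s')"
      using inv c iN by (simp add: I_def heap_frame_def)
    then show ?thesis
      using j runs_within_loop_free[of pull_step "I j" s'] by (simp add: pull_step_def)
  qed
  note loop = runs_within_While[of I, OF start this]
  show ?thesis
    unfolding pull_def
  proof (rule runs_within_mono[OF runs_within_Seq[OF loop runs_within_loop_free]])
    fix s'
    assume "(\<exists>j. I j s') \<and> \<not> bval (ILess (IVar ''i'') (IVar ''N'')) s'"
    then obtain j where I: "I j s'" and "\<not> fst s' ''i'' < fst s' ''N''"
      by auto
    moreover have "fst s' ''N'' = N"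
      using I N by (simp add: I_def heap_frame_def)
    ultimately show "heap_frame s (run (RSet ''h'' (IVar ''i'') (RNum 0)) s') \<and>
        heap_from N r (snd (run (RSet ''h'' (IVar ''i'') (RNum 0)) s') ''h'') \<and>
        (\<forall>x<r. snd (run (RSet ''h'' (IVar ''i'') (RNum 0)) s') ''h'' x = snd s ''h'' x) \<and>
        node_values N (snd (run (RSet ''h'' (IVar ''i'') (RNum 0)) s') ''h'') =
          node_values N ((snd s ''h'')(r := 0))"
      using heap_with_hole_end[of N r "fst s' ''i''" "snd s' ''h''"]
      by (simp add: I_def heap_frame_def)
  qed (simp_all add: pull_cost_def algebra_simps del: fun_upd_apply)
qed

section \<open>Computing the multiplier\<close>

definition square :: "rexp \<Rightarrow> rexp" where
  "square e = RMul e e"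

lemma rval_square [simp]: "rval (square e) s = (rval e s)\<^sup>2"
  by (simp add: square_def power2_eq_square)

abbreviation scalar :: "string \<Rightarrow> rexp" where
  "scalar x \<equiv> RCell x (INum 0)"

definition read_entry :: com where
  "read_entry =
     Seq (RSet ''r'' (INum 0) (RSub (RCell ''D'' (IVar ''k''))
           (RSub (RCell ''Xt'' (IVar ''k''))
              (RMul (RDiv (RNum 1) (scalar ''rho'')) (RCell ''Q'' (IVar ''k''))))))
    (Seq (RSet ''h'' (IAdd (IVar ''N'') (IVar ''k'')) (square (scalar ''r'')))
    (Seq (RSet ''B'' (INum 0) (RAdd (scalar ''B'') (square (scalar ''r''))))
         (ISet ''k'' (IAdd (IVar ''k'') (INum 1)))))"

definition read_input :: com where
  "read_input =
     Seq (Seq (ISet ''N'' (IMul (IVar ''m'') (IVar ''n''))) (ISet ''k'' (INum 0)))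
         (While (ILess (IVar ''k'') (IVar ''N'')) read_entry)"

definition build_heap :: com where
  "build_heap =
     Seq (ISet ''k'' (IVar ''N''))
         (While (ILess (INum 1) (IVar ''k''))
           (Seq (Seq (ISet ''k'' (ISub (IVar ''k'') (INum 1))) (ISet ''i'' (IVar ''k''))) pull))"

text \<open>With the \<open>K\<close> largest squares clipped and \<open>B\<close> the sum of the others, a positive root of the
  quartic is the solution if the last clipped square \<open>prev\<close> is above the threshold and the largest
  unclipped one, at the root of the heap, is below it. The factor \<open>K\<close> in the comparison with \<open>prev\<close>
  makes it vacuous when nothing is clipped. The test includes the equation itself, because a
  quartic without real roots leaves in the array \<open>rs\<close> what an earlier one wrote there.\<close>

definition candidate_test :: bexp where
  "candidate_test =
     BAnd (RLess (RNum 0) (scalar ''t''))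
    (BAnd (REq (RAdd (RMul (scalar ''K'') (square (RDiv (scalar ''xi'') (scalar ''t''))))
                     (RMul (square (RDiv (scalar ''rho'') (RAdd (scalar ''rho'') (scalar ''t'')))) (scalar ''B'')))
               (square (scalar ''delta'')))
    (BAnd (BNot (RLess (RMul (square (scalar ''xi'')) (square (RAdd (scalar ''rho'') (scalar ''t''))))
                       (RMul (RCell ''h'' (INum 1)) (RMul (square (scalar ''rho'')) (square (scalar ''t''))))))
          (BNot (RLess (RMul (scalar ''K'') (RMul (scalar ''prev'') (RMul (square (scalar ''rho'')) (square (scalar ''t'')))))
                       (RMul (scalar ''K'') (RMul (square (scalar ''xi'')) (square (RAdd (scalar ''rho'') (scalar ''t'')))))))))"

definition compute_candidate :: com where
  "compute_candidate =
     Seq (Quartic ''rs'' ''l''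
           (square (scalar ''delta''))
           (RMul (RMul (RNum 2) (square (scalar ''delta''))) (scalar ''rho''))
           (RSub (RSub (RMul (square (scalar ''delta'')) (square (scalar ''rho'')))
                       (RMul (scalar ''K'') (square (scalar ''xi''))))
                 (RMul (square (scalar ''rho'')) (scalar ''B'')))
           (RMul (RMul (RMul (RNum (- 2)) (scalar ''K'')) (square (scalar ''xi''))) (scalar ''rho''))
           (RMul (RMul (RSub (RNum 0) (scalar ''K'')) (square (scalar ''xi''))) (square (scalar ''rho''))))
         (RSet ''t'' (INum 0) (RCell ''rs'' (ISub (IVar ''l'') (INum 1))))"

definition try_candidate :: com where
  "try_candidate =
     Seq compute_candidate (Cond candidate_test (RSet ''theta'' (INum 0) (scalar ''t'')) Skip)"

text \<open>The square at the root of the heap becomes the last clipped one; \<open>pull\<close> then closes the hole.\<close>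

definition clip_root :: com where
  "clip_root =
     Seq (RSet ''prev'' (INum 0) (RCell ''h'' (INum 1)))
    (Seq (RSet ''B'' (INum 0) (RSub (scalar ''B'') (RCell ''h'' (INum 1))))
    (Seq (RSet ''K'' (INum 0) (RAdd (scalar ''K'') (RNum 1)))
    (Seq (ISet ''k'' (IAdd (IVar ''k'') (INum 1)))
         (ISet ''i'' (INum 1)))))"

definition search :: com where
  "search =
     Seq (ISet ''k'' (INum 0))
         (While (ILess (IVar ''k'') (IAdd (IVar ''N'') (INum 1)))
           (Seq (Seq try_candidate clip_root) pull))"

definition theta_program :: com where
  "theta_program = Seq read_input (Seq build_heap search)"

definition scalars :: "nat \<Rightarrow> real \<Rightarrow> real \<Rightarrow> real \<Rightarrow> store \<Rightarrow> bool" where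
  "scalars N \<xi> \<rho> \<delta> s \<longleftrightarrow> fst s ''N'' = N \<and> snd s ''xi'' 0 = \<xi> \<and> snd s ''rho'' 0 = \<rho> \<and> snd s ''delta'' 0 = \<delta>"

text \<open>The search relies on the initial zeros in its counter and in the output cell.\<close>

definition fresh_search :: "store \<Rightarrow> bool" where
  "fresh_search s \<longleftrightarrow> snd s ''K'' 0 = 0 \<and> snd s ''theta'' 0 = 0"

definition residual_array :: "real \<Rightarrow> real mat \<Rightarrow> real mat \<Rightarrow> real mat \<Rightarrow> nat \<Rightarrow> real" where
  "residual_array \<rho> D Xt Q k = mat_array D k - (mat_array Xt k - 1 / \<rho> * mat_array Q k)"

text \<open>Row-major order: position \<open>k\<close> holds the entry in row \<open>k div n\<close> and column \<open>k mod n\<close>.\<close>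

lemma residual_array_entries:
  assumes "D \<in> carrier_mat m n" "Xt \<in> carrier_mat m n" "Q \<in> carrier_mat m n"
  shows "squared_entries (D - q_mat \<rho> Q Xt) = {#(residual_array \<rho> D Xt Q k)\<^sup>2. k \<in># mset_set {0..<m * n}#}"
proof -
  let ?f = "\<lambda>k. (k div n, k mod n)"
  have q: "q_mat \<rho> Q Xt \<in> carrier_mat m n"
    using assms by (simp add: q_mat_carrier)
  have inj: "inj_on ?f {0..<m * n}"
    by (intro inj_onI) (metis div_mod_decomp prod.inject)
  have range: "?f ` {0..<m * n} = {0..<m} \<times> {0..<n}"
  proof (intro equalityI subsetI)
    fix p assume "p \<in> ?f ` {0..<m * n}"
    then obtain k where k: "k < m * n" "p = ?f k"
      by auto
    then have "n > 0"
      by (cases n) auto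
    then show "p \<in> {0..<m} \<times> {0..<n}"
      using k by (auto simp: less_mult_imp_div_less)
  next
    fix p assume "p \<in> {0..<m} \<times> {0..<n}"
    then obtain i j where p: "p = (i, j)" "i < m" "j < n"
      by auto
    have "i * n + j < Suc i * n"
      using p by simp
    also have "\<dots> \<le> m * n"
      using p by (intro mult_right_mono) auto
    finally show "p \<in> ?f ` {0..<m * n}"
      using p by (intro image_eqI[of _ _ "i * n + j"]) auto
  qed
  have entry: "((D - q_mat \<rho> Q Xt) $$ ?f k)\<^sup>2 = (residual_array \<rho> D Xt Q k)\<^sup>2" if "k < m * n" for k
  proof -
    have "?f k \<in> {0..<m} \<times> {0..<n}"
      unfolding range[symmetric] using that by (intro imageI) simp
    then show ?thesis
      using assms q that q_mat_entry[OF assms(3,2), of "?f k" \<rho>]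
      by (auto simp: residual_array_def mat_array_def)
  qed
  have "squared_entries (D - q_mat \<rho> Q Xt) = {#((D - q_mat \<rho> Q Xt) $$ p)\<^sup>2. p \<in># mset_set (?f ` {0..<m * n})#}"
    using q by (simp add: squared_entries_def range)
  also have "\<dots> = {#((D - q_mat \<rho> Q Xt) $$ ?f k)\<^sup>2. k \<in># mset_set {0..<m * n}#}"
    by (simp add: image_mset_mset_set[OF inj, symmetric] multiset.map_comp comp_def)
  also have "\<dots> = {#(residual_array \<rho> D Xt Q k)\<^sup>2. k \<in># mset_set {0..<m * n}#}"
    by (intro image_mset_cong entry) simp
  finally show ?thesis .
qed

definition read_cost :: "nat \<Rightarrow> nat" where
  "read_cost N = 6 + (N * (3 + max_cost read_entry + 1) + 4)"

lemma runs_within_read_input: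
  fixes \<xi> \<rho> \<delta> :: real and D Xt Q :: "real mat" and m n :: nat
  defines "V \<equiv> {#(residual_array \<rho> D Xt Q k)\<^sup>2. k \<in># mset_set {0..<m * n}#}"
  shows "runs_within read_input (input_store m n \<xi> \<rho> \<delta> D Xt Q) (read_cost (m * n))
    (\<lambda>s. scalars (m * n) \<xi> \<rho> \<delta> s \<and> fresh_search s \<and> heap_from (m * n) (m * n) (snd s ''h'') \<and> (\<forall>x<m * n. snd s ''h'' x = 0) \<and>
       node_values (m * n) (snd s ''h'') = V + replicate_mset (m * n - 1) 0 \<and> snd s ''B'' 0 = sum_mset V)"
proof -
  define N where "N = m * n"
  define r where "r = residual_array \<rho> D Xt Q"
  define I where "I j s \<longleftrightarrow> scalars N \<xi> \<rho> \<delta> s \<and> fresh_search s \<and> fst s ''k'' + j = N \<and>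
      snd s ''D'' = mat_array D \<and> snd s ''Xt'' = mat_array Xt \<and> snd s ''Q'' = mat_array Q \<and>
      snd s ''h'' = (\<lambda>x. if N \<le> x \<and> x < N + fst s ''k'' then (r (x - N))\<^sup>2 else 0) \<and>
      snd s ''B'' 0 = (\<Sum>k<fst s ''k''. (r k)\<^sup>2)" for j s
  let ?init = "Seq (ISet ''N'' (IMul (IVar ''m'') (IVar ''n''))) (ISet ''k'' (INum 0))"
  let ?s = "input_store m n \<xi> \<rho> \<delta> D Xt Q"
  have init: "runs_within ?init ?s (max_cost ?init) (I N)"
    by (intro runs_within_loop_free)
      (auto simp: I_def scalars_def fresh_search_def input_store_def scalar_array_def N_def)
  have step: "\<exists>j. k = Suc j \<and> runs_within read_entry s (max_cost read_entry) (I j)"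
    if inv: "I k s" and guard: "bval (ILess (IVar ''k'') (IVar ''N'')) s" for k s
  proof -
    define q where "q = fst s ''k''"
    have "q < N"
      using inv guard by (simp add: I_def scalars_def q_def)
    then obtain j where j: "k = Suc j"
      using inv by (cases k) (auto simp: I_def q_def)
    have h: "(snd s ''h'')(N + q := (r q)\<^sup>2) = (\<lambda>x. if N \<le> x \<and> x < N + Suc q then (r (x - N))\<^sup>2 else 0)"
      using inv by (auto simp: I_def q_def fun_eq_iff)
    have "I j (run read_entry s)"
      using inv j h unfolding I_def
      by (simp add: read_entry_def scalars_def fresh_search_def residual_array_def r_def q_def)
    then show ?thesis
      using j runs_within_loop_free[of read_entry "I j" s] by (simp add: read_entry_def)
  qed
  show ?thesis
    unfolding read_input_def
  proof (rule runs_within_mono[OF runs_within_Seq[OF init runs_within_While[where I = I and k = N, OF _ step]]])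
    fix s assume "(\<exists>j. I j s) \<and> \<not> bval (ILess (IVar ''k'') (IVar ''N'')) s"
    then obtain j where I: "I j s" and "\<not> fst s ''k'' < fst s ''N''"
      by auto
    then have k: "fst s ''k'' = N"
      by (auto simp: I_def scalars_def)
    define T where "T = snd s ''h''"
    have T: "T = (\<lambda>x. if N \<le> x \<and> x < N + N then (r (x - N))\<^sup>2 else 0)"
      using I k by (simp add: I_def T_def)
    have "node_values N T = V + replicate_mset (N - 1) 0"
    proof -
      have split: "{1..<2 * N} = {1..<N} \<union> {N..<2 * N}" "{1..<N} \<inter> {N..<2 * N} = {}" if "N \<ge> 1"
        using that by auto
      have leaves: "{#T x. x \<in># mset_set {N..<2 * N}#} = V"
      proof -
        have "{N..<2 * N} = (\<lambda>k. k + N) ` {0..<N}"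
          by (simp add: mult_2)
        then have "{#T x. x \<in># mset_set {N..<2 * N}#} = {#T (k + N). k \<in># mset_set {0..<N}#}"
          by (simp add: image_mset_mset_set[symmetric] multiset.map_comp comp_def del: image_add_atLeastLessThan' image_add_atLeastLessThan)
        also have "\<dots> = V"
          unfolding V_def N_def[symmetric] by (intro image_mset_cong) (auto simp: T r_def)
        finally show ?thesis .
      qed
      have "{#T x. x \<in># mset_set {1..<N}#} = {#0. x \<in># mset_set {1..<N}#}"
        by (intro image_mset_cong) (auto simp: T)
      then have "{#T x. x \<in># mset_set {1..<N}#} = replicate_mset (N - 1) 0"
        by (simp add: image_mset_const_eq)
      then show ?thesis
        using leaves split by (cases "N \<ge> 1") (auto simp: node_values_def mset_set_Union)
    qed
    moreover have "heap_from N N T" "\<forall>x<N. T x = 0"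
      by (auto simp: heap_from_def T)
    moreover have "sum_mset V = (\<Sum>k<N. (r k)\<^sup>2)"
      by (simp add: V_def r_def N_def sum_unfold_sum_mset lessThan_atLeast0)
    ultimately show "scalars (m * n) \<xi> \<rho> \<delta> s \<and> fresh_search s \<and> heap_from (m * n) (m * n) (snd s ''h'') \<and> (\<forall>x<m * n. snd s ''h'' x = 0) \<and>
       node_values (m * n) (snd s ''h'') = V + replicate_mset (m * n - 1) 0 \<and> snd s ''B'' 0 = sum_mset V"
      using I k by (simp add: I_def T_def N_def)
  qed (simp_all add: read_cost_def N_def algebra_simps)
qed

definition build_cost :: "nat \<Rightarrow> nat \<Rightarrow> nat" where
  "build_cost N d = 2 + (N * (3 + (6 + pull_cost d) + 1) + 4)"

lemma runs_within_build_heap: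
  assumes "scalars N \<xi> \<rho> \<delta> s" "fresh_search s" "heap_from N N (snd s ''h'')" "\<forall>x<N. snd s ''h'' x = 0"
    and "node_values N (snd s ''h'') = M" "snd s ''B'' 0 = B" "N \<ge> 1" "N \<le> 2 ^ d"
  shows "runs_within build_heap s (build_cost N d)
    (\<lambda>s. scalars N \<xi> \<rho> \<delta> s \<and> fresh_search s \<and> heap_from N 1 (snd s ''h'') \<and>
       node_values N (snd s ''h'') = M \<and> snd s ''B'' 0 = B)"
proof -
  define I where "I j s \<longleftrightarrow> scalars N \<xi> \<rho> \<delta> s \<and> fresh_search s \<and> j = fst s ''k'' \<and> 1 \<le> fst s ''k'' \<and>
      fst s ''k'' \<le> N \<and> heap_from N (fst s ''k'') (snd s ''h'') \<and> (\<forall>x<fst s ''k''. snd s ''h'' x = 0) \<and>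
      node_values N (snd s ''h'') = M \<and> snd s ''B'' 0 = B" for j s
  let ?prep = "Seq (ISet ''k'' (ISub (IVar ''k'') (INum 1))) (ISet ''i'' (IVar ''k''))"
  have init: "runs_within (ISet ''k'' (IVar ''N'')) s (max_cost (ISet ''k'' (IVar ''N''))) (I N)"
    using assms by (intro runs_within_loop_free) (auto simp: I_def scalars_def fresh_search_def)
  have step: "\<exists>j. k = Suc j \<and> runs_within (Seq ?prep pull) s (max_cost ?prep + pull_cost d) (I j)"
    if inv: "I k s" and guard: "bval (ILess (INum 1) (IVar ''k'')) s" for k s
  proof -
    obtain r where r: "fst s ''k'' = Suc r" "1 \<le> r"
      using guard by (cases "fst s ''k''") auto
    define s1 where "s1 = run ?prep s"
    have s1: "fst s1 ''k'' = r" "fst s1 ''i'' = r" "scalars N \<xi> \<rho> \<delta> s1" "fresh_search s1"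
        "snd s1 = snd s" "fst s1 ''N'' = N"
      using inv r by (auto simp: I_def s1_def scalars_def fresh_search_def)
    have prep: "runs_within ?prep s (max_cost ?prep) (\<lambda>s'. s' = s1)"
      by (intro runs_within_loop_free) (simp_all add: s1_def)
    have heap: "heap_from N (Suc r) (snd s1 ''h'')" and rN: "r < 2 * N" "r < N"
      using inv r s1 by (auto simp: I_def)
    have "runs_within pull s1 (pull_cost d) (I r)"
    proof (rule runs_within_mono[OF runs_within_pull[OF s1(2) r(2) rN(1) s1(6) assms(8) heap] order_refl])
      fix s'
      assume s': "heap_frame s1 s' \<and> heap_from N r (snd s' ''h'') \<and>
        (\<forall>x<r. snd s' ''h'' x = snd s1 ''h'' x) \<and>
        node_values N (snd s' ''h'') = node_values N ((snd s1 ''h'')(r := 0))"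
      (* no value is lost: the hole at r has been empty from the start *)
      have "(snd s1 ''h'')(r := 0) = snd s1 ''h''"
        using inv r s1(5) by (auto simp: I_def)
      then show "I r s'"
        using s' inv r rN s1 by (simp add: I_def heap_frame_def scalars_def fresh_search_def)
    qed
    then have "runs_within (Seq ?prep pull) s (max_cost ?prep + pull_cost d) (I r)"
      using runs_within_Seq[OF prep] by blast
    then show ?thesis
      using inv r by (auto simp: I_def)
  qed
  show ?thesis
    unfolding build_heap_def
  proof (rule runs_within_mono[OF runs_within_Seq[OF init runs_within_While[where I = I and k = N, OF _ step]]])
    fix s assume "(\<exists>j. I j s) \<and> \<not> bval (ILess (INum 1) (IVar ''k'')) s"
    then obtain j where I: "I j s" and "fst s ''k'' \<le> 1"
      by auto
    then have "fst s ''k'' = 1"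
      by (simp add: I_def)
    then show "scalars N \<xi> \<rho> \<delta> s \<and> fresh_search s \<and> heap_from N 1 (snd s ''h'') \<and>
       node_values N (snd s ''h'') = M \<and> snd s ''B'' 0 = B"
      using I by (simp add: I_def)
  qed (simp_all add: build_cost_def algebra_simps)
qed

subsection \<open>The search for the root\<close>

definition solves :: "real \<Rightarrow> real \<Rightarrow> real \<Rightarrow> real multiset \<Rightarrow> real \<Rightarrow> bool" where
  "solves \<xi> \<rho> \<delta> V t \<longleftrightarrow> t > 0 \<and> clipped_sum \<xi> \<rho> V t = \<delta>\<^sup>2"

text \<open>\<open>P\<close> collects the clipped squares, \<open>M\<close> the others; the zeros are the empty nodes, which do not
  contribute to \<open>clipped_sum\<close>. A solution that has not been found yet has its threshold below every
  element of \<open>P\<close>.\<close>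

definition search_state ::
  "real \<Rightarrow> real \<Rightarrow> real \<Rightarrow> real multiset \<Rightarrow> real multiset \<Rightarrow> real multiset \<Rightarrow> real \<Rightarrow> real \<Rightarrow> bool" where
  "search_state \<xi> \<rho> \<delta> V P M prev \<theta> \<longleftrightarrow>
     (\<exists>z. P + M = V + replicate_mset z 0) \<and> (\<forall>x\<in>#P. \<forall>y\<in>#M. y \<le> x) \<and>
     (\<forall>x\<in>#P. prev \<le> x) \<and> (P = {#} \<or> prev \<in># P) \<and> (\<theta> = 0 \<or> solves \<xi> \<rho> \<delta> V \<theta>) \<and>
     (\<forall>t. solves \<xi> \<rho> \<delta> V t \<longrightarrow> \<theta> = t \<or> (\<forall>x\<in>#P. \<xi>\<^sup>2 * (\<rho> + t)\<^sup>2 < x * (\<rho>\<^sup>2 * t\<^sup>2)))"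

text \<open>The meaning of \<open>candidate_test\<close> in terms of \<open>P\<close> and \<open>M\<close>.\<close>

definition accepts :: "real \<Rightarrow> real \<Rightarrow> real \<Rightarrow> real multiset \<Rightarrow> real multiset \<Rightarrow> real \<Rightarrow> real \<Rightarrow> real \<Rightarrow> bool" where
  "accepts \<xi> \<rho> \<delta> P M prev peak t \<longleftrightarrow> 0 < t \<and>
     real (size P) * (\<xi> / t)\<^sup>2 + (\<rho> / (\<rho> + t))\<^sup>2 * sum_mset M = \<delta>\<^sup>2 \<and>
     \<not> \<xi>\<^sup>2 * (\<rho> + t)\<^sup>2 < peak * (\<rho>\<^sup>2 * t\<^sup>2) \<and>
     \<not> real (size P) * (prev * (\<rho>\<^sup>2 * t\<^sup>2)) < real (size P) * (\<xi>\<^sup>2 * (\<rho> + t)\<^sup>2)"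

context
  fixes \<xi> \<rho> \<delta> :: real and V P M :: "real multiset" and prev peak \<theta> :: real
  assumes pos: "\<xi> > 0" "\<rho> > 0" "\<delta> > 0"
    and state: "search_state \<xi> \<rho> \<delta> V P M prev \<theta>"
    and peak: "peak \<in># M" "\<And>x. x \<in># M \<Longrightarrow> x \<le> peak"
begin

lemma clipped_sum_state:
  assumes "t > 0" "\<And>x. x \<in># P \<Longrightarrow> \<xi>\<^sup>2 * (\<rho> + t)\<^sup>2 \<le> x * (\<rho>\<^sup>2 * t\<^sup>2)" "peak * (\<rho>\<^sup>2 * t\<^sup>2) \<le> \<xi>\<^sup>2 * (\<rho> + t)\<^sup>2"
  shows "clipped_sum \<xi> \<rho> V t = real (size P) * (\<xi> / t)\<^sup>2 + (\<rho> / (\<rho> + t))\<^sup>2 * sum_mset M"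
proof -
  obtain z where "P + M = V + replicate_mset z 0"
    using state by (auto simp: search_state_def)
  moreover have "x * (\<rho>\<^sup>2 * t\<^sup>2) \<le> \<xi>\<^sup>2 * (\<rho> + t)\<^sup>2" if "x \<in># M" for x
    using mult_right_mono[OF peak(2)[OF that], of "\<rho>\<^sup>2 * t\<^sup>2"] assms(3) by simp
  ultimately show ?thesis
    using clipped_sum_partition[OF pos(1,2) assms(1,2), of P M] clipped_sum_add_zeros by metis
qed

lemma accepts_sound:
  assumes "accepts \<xi> \<rho> \<delta> P M prev peak t"
  shows "solves \<xi> \<rho> \<delta> V t"
proof -
  have "\<xi>\<^sup>2 * (\<rho> + t)\<^sup>2 \<le> x * (\<rho>\<^sup>2 * t\<^sup>2)" if "x \<in># P" for x
  proof -
    have "real (size P) > 0"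
      using that by (metis empty_iff nonempty_has_size of_nat_0_less_iff set_mset_empty)
    then have "\<xi>\<^sup>2 * (\<rho> + t)\<^sup>2 \<le> prev * (\<rho>\<^sup>2 * t\<^sup>2)"
      using assms by (auto simp: accepts_def not_less)
    also have "\<dots> \<le> x * (\<rho>\<^sup>2 * t\<^sup>2)"
      using state that by (intro mult_right_mono) (auto simp: search_state_def)
    finally show ?thesis .
  qed
  then show ?thesis
    using assms clipped_sum_state[of t] by (auto simp: solves_def accepts_def)
qed

text \<open>A solution whose threshold separates \<open>M\<close> from \<open>P\<close> is the candidate and passes the test.\<close>

lemma accepts_complete:
  assumes "solves \<xi> \<rho> \<delta> V t" "\<And>x. x \<in># P \<Longrightarrow> \<xi>\<^sup>2 * (\<rho> + t)\<^sup>2 < x * (\<rho>\<^sup>2 * t\<^sup>2)"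
    and "\<not> \<xi>\<^sup>2 * (\<rho> + t)\<^sup>2 < peak * (\<rho>\<^sup>2 * t\<^sup>2)"
  shows "accepts \<xi> \<rho> \<delta> P M prev peak t"
proof -
  have "real (size P) * (\<xi> / t)\<^sup>2 + (\<rho> / (\<rho> + t))\<^sup>2 * sum_mset M = \<delta>\<^sup>2"
    using clipped_sum_state[of t] assms by (force simp: solves_def)
  moreover have "\<not> real (size P) * (prev * (\<rho>\<^sup>2 * t\<^sup>2)) < real (size P) * (\<xi>\<^sup>2 * (\<rho> + t)\<^sup>2)"
  proof (cases "P = {#}")
    case False
    then have "\<xi>\<^sup>2 * (\<rho> + t)\<^sup>2 < prev * (\<rho>\<^sup>2 * t\<^sup>2)"
      using state assms(2) by (auto simp: search_state_def)
    then show ?thesis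
      by (simp add: not_less mult_left_mono)
  qed simp
  ultimately show ?thesis
    using assms by (simp add: accepts_def solves_def)
qed

end

lemma solves_unique:
  assumes "\<xi> > 0" "\<rho> > 0" "\<delta> > 0" "\<And>x. x \<in># V \<Longrightarrow> 0 \<le> x" "solves \<xi> \<rho> \<delta> V t" "solves \<xi> \<rho> \<delta> V t'"
  shows "t = t'"
  using clipped_sum_root_unique[OF assms(1,2,4), where c = "\<delta>\<^sup>2" and \<theta> = t and \<theta>' = t'] assms by (auto simp: solves_def)

text \<open>For a solution not found before, either its threshold lies below \<open>peak\<close>, and then below all of
  the new \<open>P\<close>, or it separates \<open>M\<close> from \<open>P\<close>, and then it is the candidate that is accepted now.\<close>

lemma search_state_step:
  assumes pos: "\<xi> > 0" "\<rho> > 0" "\<delta> > 0" "\<And>x. x \<in># V \<Longrightarrow> 0 \<le> x"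
    and state: "search_state \<xi> \<rho> \<delta> V P M prev \<theta>"
    and peak: "peak \<in># M" "\<And>x. x \<in># M \<Longrightarrow> x \<le> peak" "0 \<le> peak"
    and candidate: "\<And>t'. t' > 0 \<Longrightarrow>
        real (size P) * (\<xi> / t')\<^sup>2 + (\<rho> / (\<rho> + t'))\<^sup>2 * sum_mset M = \<delta>\<^sup>2 \<Longrightarrow> t = t'"
    and M': "add_mset peak M' = add_mset 0 M"
  shows "search_state \<xi> \<rho> \<delta> V (add_mset peak P) M' peak
    (if accepts \<xi> \<rho> \<delta> P M prev peak t then t else \<theta>)"
proof -
  let ?\<theta> = "if accepts \<xi> \<rho> \<delta> P M prev peak t then t else \<theta>"
  note sound = accepts_sound[OF pos(1-3) state peak(1,2)]
  note complete = accepts_complete[OF pos(1-3) state peak(1,2)]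
  obtain z where z: "P + M = V + replicate_mset z 0"
    using state by (auto simp: search_state_def)
  have zeros: "add_mset peak P + M' = V + replicate_mset (Suc z) 0"
    using z M' by (metis add_mset_add_single replicate_mset_Suc union_mset_add_mset_left union_mset_add_mset_right)
  have y: "y \<le> peak" if "y \<in># M'" for y
  proof -
    have "y \<in># add_mset 0 M"
      using that M' by (metis union_iff add_mset_add_single)
    then show ?thesis
      using peak by auto
  qed
  have x: "peak \<le> x" if "x \<in># P" for x
    using state that peak(1) by (auto simp: search_state_def)
  have sol: "?\<theta> = 0 \<or> solves \<xi> \<rho> \<delta> V ?\<theta>"
    using state sound by (auto simp: search_state_def)
  have pending: "?\<theta> = t' \<or> (\<forall>x\<in>#add_mset peak P. \<xi>\<^sup>2 * (\<rho> + t')\<^sup>2 < x * (\<rho>\<^sup>2 * t'\<^sup>2))"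
    if t': "solves \<xi> \<rho> \<delta> V t'" for t'
  proof (cases "accepts \<xi> \<rho> \<delta> P M prev peak t")
    case True
    then show ?thesis
      using solves_unique[OF pos] sound t' by auto
  next
    case False
    consider "\<theta> = t'" | "\<forall>x\<in>#P. \<xi>\<^sup>2 * (\<rho> + t')\<^sup>2 < x * (\<rho>\<^sup>2 * t'\<^sup>2)"
      using state t' by (auto simp: search_state_def)
    then show ?thesis
    proof cases
      case 2
      have "\<xi>\<^sup>2 * (\<rho> + t')\<^sup>2 < peak * (\<rho>\<^sup>2 * t'\<^sup>2)"
      proof (rule ccontr)
        assume "\<not> ?thesis"
        then have "accepts \<xi> \<rho> \<delta> P M prev peak t'"
          using complete[OF _ t'] 2 by blast
        moreover from this have "t = t'"
          using candidate by (simp add: accepts_def)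
        ultimately show False
          using False by simp
      qed
      then show ?thesis
        using 2 by simp
    qed (use False in simp)
  qed
  show ?thesis
    unfolding search_state_def
  proof (intro conjI)
    show "\<exists>z. add_mset peak P + M' = V + replicate_mset z 0"
      using zeros by blast
    show "\<forall>x\<in>#add_mset peak P. \<forall>y\<in>#M'. y \<le> x"
      using x y by (auto intro: order_trans)
    show "\<forall>x\<in>#add_mset peak P. peak \<le> x"
      using x by auto
    show "\<forall>t. solves \<xi> \<rho> \<delta> V t \<longrightarrow> ?\<theta> = t \<or>
        (\<forall>x\<in>#add_mset peak P. \<xi>\<^sup>2 * (\<rho> + t)\<^sup>2 < x * (\<rho>\<^sup>2 * t\<^sup>2))"
      using pending by blast
  qed (simp_all add: sol)
qed

text \<open>The search makes one step more than there are squares, so at the end \<open>P\<close> contains a padding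
  zero. No threshold lies below zero, hence no solution can have been missed.\<close>

lemma search_state_final:
  assumes pos: "\<xi> > 0" "\<rho> > 0" "\<delta> > 0"
    and state: "search_state \<xi> \<rho> \<delta> (squared_entries R) P M prev \<theta>"
    and size: "size (squared_entries R) < size P"
  shows "\<theta> = theta_star \<xi> \<rho> \<delta> R"
proof -
  let ?V = "squared_entries R"
  have found: "\<theta> = t" if "solves \<xi> \<rho> \<delta> ?V t" for t
  proof (rule ccontr)
    assume "\<theta> \<noteq> t"
    then have lt: "\<xi>\<^sup>2 * (\<rho> + t)\<^sup>2 < x * (\<rho>\<^sup>2 * t\<^sup>2)" if "x \<in># P" for x
      using state \<open>solves \<xi> \<rho> \<delta> ?V t\<close> that by (auto simp: search_state_def)
    have "0 < x" if "x \<in># P" for x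
    proof -
      have "0 \<le> \<xi>\<^sup>2 * (\<rho> + t)\<^sup>2"
        by simp
      then have "0 < x * (\<rho>\<^sup>2 * t\<^sup>2)"
        using lt[OF that] by linarith
      moreover have "0 < \<rho>\<^sup>2 * t\<^sup>2"
        using pos \<open>solves \<xi> \<rho> \<delta> ?V t\<close> by (simp add: solves_def)
      ultimately show ?thesis
        using zero_less_mult_pos2 by blast
    qed
    then have "filter_mset (\<lambda>x. 0 < x) P = P"
      by (simp add: filter_mset_eq_conv)
    moreover obtain z where "P + M = ?V + replicate_mset z 0"
      using state by (auto simp: search_state_def)
    then have "filter_mset (\<lambda>x. 0 < x) (P + M) = filter_mset (\<lambda>x. 0 < x) (?V + replicate_mset z 0)"
      by simp
    moreover have "filter_mset (\<lambda>x. 0 < x) (replicate_mset z (0::real)) = {#}" for z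
      by (induction z) auto
    ultimately have "P + filter_mset (\<lambda>x. 0 < x) M = filter_mset (\<lambda>x. 0 < x) ?V"
      by simp
    then have "size P \<le> size (filter_mset (\<lambda>x. 0 < x) ?V)"
      by (metis le_add1 size_union)
    also have "\<dots> \<le> size ?V"
      by (rule size_filter_mset_lesseq)
    finally show False
      using size by simp
  qed
  show ?thesis
  proof (cases "\<exists>t. solves \<xi> \<rho> \<delta> ?V t")
    case True
    then show ?thesis
      using found theta_star_eq[OF pos] by (auto simp: solves_def)
  next
    case False
    then show ?thesis
      using state theta_star_eq_0[OF pos] by (auto simp: solves_def search_state_def)
  qed
qed

definition search_cost :: "nat \<Rightarrow> nat \<Rightarrow> nat" where
  "search_cost N d = 2 + (Suc N * (5 + (max_cost (Seq try_candidate clip_root) + pull_cost d) + 1) + 6)"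

lemma runs_within_search:
  assumes pos: "\<xi> > 0" "\<rho> > 0" "\<delta> > 0"
    and N: "N \<ge> 1" "N \<le> 2 ^ d" "size (squared_entries R) = N"
    and s: "scalars N \<xi> \<rho> \<delta> s" "fresh_search s" "heap_from N 1 (snd s ''h'')"
      "node_values N (snd s ''h'') = squared_entries R + replicate_mset z 0"
      "snd s ''B'' 0 = sum_mset (squared_entries R)"
  shows "runs_within search s (search_cost N d) (\<lambda>s. theta_output s = theta_star \<xi> \<rho> \<delta> R)"
proof -
  define V where "V = squared_entries R"
  have V: "0 \<le> x" if "x \<in># V" for x
    using that squared_entries_nonneg by (simp add: V_def)
  define I where "I j s \<longleftrightarrow> scalars N \<xi> \<rho> \<delta> s \<and> fst s ''k'' + j = Suc N \<and> heap_from N 1 (snd s ''h'') \<and>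
      snd s ''B'' 0 = sum_mset (node_values N (snd s ''h'')) \<and> snd s ''K'' 0 = real (fst s ''k'') \<and>
      (\<exists>P. size P = fst s ''k'' \<and>
         search_state \<xi> \<rho> \<delta> V P (node_values N (snd s ''h'')) (snd s ''prev'' 0) (snd s ''theta'' 0))" for j s
  have init: "runs_within (ISet ''k'' (INum 0)) s (max_cost (ISet ''k'' (INum 0))) (I (Suc N))"
    using s by (intro runs_within_loop_free)
      (auto simp: I_def scalars_def fresh_search_def search_state_def V_def intro!: exI[of _ z])
  have step: "\<exists>j. k = Suc j \<and> runs_within (Seq (Seq try_candidate clip_root) pull) s
        (max_cost (Seq try_candidate clip_root) + pull_cost d) (I j)"
    if inv: "I k s" and guard: "bval (ILess (IVar ''k'') (IAdd (IVar ''N'') (INum 1))) s" for k s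
  proof -
    obtain j where j: "k = Suc j"
      using inv guard by (cases k) (auto simp: I_def scalars_def)
    define T where "T = snd s ''h''"
    define M where "M = node_values N T"
    define K where "K = fst s ''k''"
    define prev where "prev = snd s ''prev'' 0"
    define \<theta> where "\<theta> = snd s ''theta'' 0"
    define rs where "rs = quartic_roots (\<delta>\<^sup>2) (2 * \<delta>\<^sup>2 * \<rho>) (\<delta>\<^sup>2 * \<rho>\<^sup>2 - real K * \<xi>\<^sup>2 - \<rho>\<^sup>2 * sum_mset M)
      (- 2 * real K * \<xi>\<^sup>2 * \<rho>) (- real K * \<xi>\<^sup>2 * \<rho>\<^sup>2)"
    define t where "t = (if length rs - 1 < length rs then rs ! (length rs - 1) else snd s ''rs'' (length rs - 1))"
    obtain P where P: "size P = K" "search_state \<xi> \<rho> \<delta> V P M prev \<theta>"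
      using inv by (auto simp: I_def K_def M_def T_def prev_def \<theta>_def)
    have heap: "heap_from N 1 T"
      using inv by (simp add: I_def T_def)
    have peak: "T 1 \<in># M" "x \<le> T 1" "0 \<le> x" if "x \<in># M" for x
      using that N heap heap_root_max[OF heap] by (auto simp: M_def node_values_def heap_from_def)
    have peak1: "T 1 \<in># M"
      using N by (auto simp: M_def node_values_def)
    have "0 \<le> sum_mset M"
      using peak(3) by (induction M) (auto intro: add_nonneg_nonneg)
    then have candidate: "t = t'"
      if "t' > 0" "real (size P) * (\<xi> / t')\<^sup>2 + (\<rho> / (\<rho> + t'))\<^sup>2 * sum_mset M = \<delta>\<^sup>2" for t'
      using last_quartic_root[OF pos(2,3) _ _ that] by (simp add: t_def rs_def P(1))
    define s0 where "s0 = run compute_candidate s"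
    have inputs: "snd s ''xi'' 0 = \<xi>" "snd s ''rho'' 0 = \<rho>" "snd s ''delta'' 0 = \<delta>" "snd s ''K'' 0 = real K"
        "snd s ''B'' 0 = sum_mset M" "fst s ''N'' = N"
      using inv by (simp_all add: I_def scalars_def K_def M_def T_def)
    have s0: "fst s0 = (fst s)(''l'' := length rs)" "snd s0 ''t'' 0 = t"
        "\<And>x. x \<noteq> ''rs'' \<Longrightarrow> x \<noteq> ''t'' \<Longrightarrow> snd s0 x = snd s x"
      by (simp_all add: s0_def compute_candidate_def store_list_def inputs rs_def t_def)
    have test: "bval candidate_test s0 \<longleftrightarrow> accepts \<xi> \<rho> \<delta> P M prev (T 1) t"
      by (simp add: candidate_test_def accepts_def s0 inputs P(1) prev_def T_def)
    define s1 where "s1 = run (Seq try_candidate clip_root) s"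
    define \<theta>1 where "\<theta>1 = (if accepts \<xi> \<rho> \<delta> P M prev (T 1) t then t else \<theta>)"
    have s1: "fst s1 ''k'' = Suc K" "fst s1 ''i'' = 1" "scalars N \<xi> \<rho> \<delta> s1" "snd s1 ''h'' = T"
        "snd s1 ''B'' 0 = sum_mset M - T 1" "snd s1 ''K'' 0 = real (Suc K)" "snd s1 ''prev'' 0 = T 1"
        "snd s1 ''theta'' 0 = \<theta>1"
      using test by (auto simp: s1_def try_candidate_def clip_root_def s0_def[symmetric] s0 inputs
          scalars_def K_def T_def \<theta>1_def \<theta>_def)
    have prep: "runs_within (Seq try_candidate clip_root) s (max_cost (Seq try_candidate clip_root)) (\<lambda>s'. s' = s1)"
      by (intro runs_within_loop_free) (simp_all add: s1_def try_candidate_def compute_candidate_def clip_root_def)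
    have N1: "fst s1 ''N'' = N" "(1::nat) \<le> 1" "1 < 2 * N"
      using s1(3) N by (simp_all add: scalars_def)
    have heap1: "heap_from N (Suc 1) (snd s1 ''h'')"
      using heap by (simp add: heap_from_def s1(4))
    have "runs_within pull s1 (pull_cost d) (I j)"
    proof (rule runs_within_mono[OF runs_within_pull[OF s1(2) N1(2,3,1) N(2) heap1] order_refl])
      fix s'
      assume s': "heap_frame s1 s' \<and> heap_from N 1 (snd s' ''h'') \<and>
        (\<forall>x<1. snd s' ''h'' x = snd s1 ''h'' x) \<and>
        node_values N (snd s' ''h'') = node_values N ((snd s1 ''h'')(1 := 0))"
      define M' where "M' = node_values N (snd s' ''h'')"
      have M': "add_mset (T 1) M' = add_mset 0 M"
        using node_values_remove[OF N1(2,3), of T] s' s1(4) by (simp add: M'_def M_def)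
      have "search_state \<xi> \<rho> \<delta> V (add_mset (T 1) P) M' (T 1) \<theta>1"
        unfolding \<theta>1_def
        using search_state_step[OF pos V P(2) peak1 peak(2) peak(3)[OF peak1] candidate M'] .
      moreover have "sum_mset M' = sum_mset M - T 1"
        using arg_cong[OF M', of sum_mset] by simp
      moreover have "fst s' ''k'' = Suc K" "scalars N \<xi> \<rho> \<delta> s'" "snd s' ''B'' 0 = sum_mset M - T 1"
          "snd s' ''K'' 0 = real (Suc K)" "snd s' ''prev'' 0 = T 1" "snd s' ''theta'' 0 = \<theta>1"
        using s' s1 by (simp_all add: heap_frame_def scalars_def)
      moreover have "K + Suc j = Suc N"
        using inv j by (simp add: I_def K_def)
      moreover have "size (add_mset (T 1) P) = Suc K"
        using P(1) by simp
      ultimately show "I j s'"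
        using s' unfolding I_def M'_def by (metis add_Suc_shift)
    qed
    then show ?thesis
      using j runs_within_Seq[OF prep] by blast
  qed
  show ?thesis
    unfolding search_def
  proof (rule runs_within_mono[OF runs_within_Seq[OF init runs_within_While[where I = I and k = "Suc N", OF _ step]]])
    fix s assume "(\<exists>j. I j s) \<and> \<not> bval (ILess (IVar ''k'') (IAdd (IVar ''N'') (INum 1))) s"
    then obtain j P where I: "I j s" and "N < fst s ''k''" and P: "size P = fst s ''k''"
      "search_state \<xi> \<rho> \<delta> V P (node_values N (snd s ''h'')) (snd s ''prev'' 0) (snd s ''theta'' 0)"
      by (auto simp: I_def scalars_def)
    then show "theta_output s = theta_star \<xi> \<rho> \<delta> R"
      using search_state_final[OF pos P(2)[unfolded V_def]] N by (simp add: theta_output_def)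
  qed (simp_all add: search_cost_def algebra_simps)
qed

subsection \<open>Total running time\<close>

lemma runs_within_theta_program:
  assumes pos: "\<xi> > 0" "\<rho> > 0" "\<delta> > 0" "0 < m" "0 < n"
    and carrier: "D \<in> carrier_mat m n" "Xt \<in> carrier_mat m n" "Q \<in> carrier_mat m n"
    and d: "m * n \<le> 2 ^ d"
  shows "runs_within theta_program (input_store m n \<xi> \<rho> \<delta> D Xt Q)
    (read_cost (m * n) + (build_cost (m * n) d + search_cost (m * n) d))
    (\<lambda>s. theta_output s = theta_star \<xi> \<rho> \<delta> (D - q_mat \<rho> Q Xt))"
proof -
  have N: "m * n \<ge> 1"
    using pos by simp
  note entries = residual_array_entries[OF carrier, of \<rho>]
  have size: "size (squared_entries (D - q_mat \<rho> Q Xt)) = m * n"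
    by (simp add: entries)
  note read = runs_within_read_input[where m = m and n = n and \<xi> = \<xi> and \<rho> = \<rho> and \<delta> = \<delta>
      and D = D and Xt = Xt and Q = Q, folded entries]
  show ?thesis
    unfolding theta_program_def
    by (rule runs_within_Seq[OF read], elim conjE,
        rule runs_within_Seq[OF runs_within_build_heap[OF _ _ _ _ _ _ N d]], assumption+, elim conjE,
        rule runs_within_search[OF pos(1-3) N d size], assumption+)
qed

definition cost_factor :: nat where
  "cost_factor = 60 + max_cost read_entry + max_cost (Seq try_candidate clip_root) + 2 * max_cost pull_step"

lemma total_cost_le:
  "read_cost N + (build_cost N d + search_cost N d) \<le> cost_factor * (Suc N * Suc d)"
  unfolding read_cost_def build_cost_def search_cost_def pull_cost_def cost_factor_def
  by (simp add: algebra_simps)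

text \<open>With \<open>d = \<lceil>log 2 N\<rceil>\<close> one has \<open>Suc N \<le> 2 * N\<close> and \<open>Suc d \<le> 3 * log 2 N\<close> for \<open>N \<ge> 2\<close>, which gives the
  constant; for \<open>N = 1\<close> the logarithm vanishes and the maximum with \<open>1\<close> takes over.\<close>

lemma log_depth_exists:
  assumes "N \<ge> 1"
  shows "\<exists>d. N \<le> 2 ^ d \<and> real (Suc N * Suc d) \<le> 6 / ln 2 * max 1 (real N * ln (real N))"
proof -
  define d where "d = nat \<lceil>log 2 (real N)\<rceil>"
  have log: "0 \<le> log 2 (real N)"
    using assms by simp
  have "log 2 (real N) \<le> real d" and d: "real d \<le> log 2 (real N) + 1"
    using log unfolding d_def by linarith+
  then have "real N \<le> 2 powr real d"
    using assms by (simp add: log_le_iff)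
  then have "real N \<le> real (2 ^ d)"
    by (simp add: powr_realpow)
  then have N: "N \<le> 2 ^ d"
    using of_nat_le_iff by blast
  have "ln 2 \<le> (1::real)" "(0::real) < ln 2"
    using ln_le_minus_one[of "2::real"] by auto
  have "real (Suc N * Suc d) \<le> 6 / ln 2 * max 1 (real N * ln (real N))"
  proof (cases "N = 1")
    case True
    then have "d = 0"
      by (simp add: d_def)
    have "2 * ln 2 \<le> (6::real)"
      using \<open>ln 2 \<le> (1::real)\<close> by linarith
    then show ?thesis
      using True \<open>d = 0\<close> \<open>0 < ln 2\<close> by (simp add: field_simps)
  next
    case False
    then have N2: "2 \<le> real N"
      using assms by simp
    then have log1: "1 \<le> log 2 (real N)"
      by simp
    then have depth: "real d + 1 \<le> 3 * log 2 (real N)"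
      using d by linarith
    have "real (Suc N * Suc d) = (real N + 1) * (real d + 1)"
      by (simp add: algebra_simps)
    also have "\<dots> \<le> (2 * real N) * (3 * log 2 (real N))"
      using N2 by (intro mult_mono[OF _ depth]) auto
    also have "\<dots> = 6 / ln 2 * (real N * ln (real N))"
      by (simp add: log_def)
    also have "\<dots> \<le> 6 / ln 2 * max 1 (real N * ln (real N))"
      using \<open>0 < ln 2\<close> by (intro mult_left_mono) auto
    finally show ?thesis .
  qed
  then show ?thesis
    using N by blast
qed


lemma theta_program_fast:
  assumes pos: "\<xi> > 0" "\<rho> > 0" "\<delta> > 0" "0 < m" "0 < n"
    and carrier: "D \<in> carrier_mat m n" "Xt \<in> carrier_mat m n" "Q \<in> carrier_mat m n"
  shows "\<exists>t s. exec theta_program (input_store m n \<xi> \<rho> \<delta> D Xt Q) t s \<and>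
    theta_output s = theta_star \<xi> \<rho> \<delta> (D - q_mat \<rho> Q Xt) \<and>
    real t \<le> real cost_factor * (6 / ln 2) * max 1 (real (m * n) * ln (real (m * n)))"
proof -
  have "m * n \<ge> 1"
    using pos by simp
  then obtain d where d: "m * n \<le> 2 ^ d"
    "real (Suc (m * n) * Suc d) \<le> 6 / ln 2 * max 1 (real (m * n) * ln (real (m * n)))"
    using log_depth_exists by blast
  have "runs_within theta_program (input_store m n \<xi> \<rho> \<delta> D Xt Q) (cost_factor * (Suc (m * n) * Suc d))
      (\<lambda>s. theta_output s = theta_star \<xi> \<rho> \<delta> (D - q_mat \<rho> Q Xt))"
    by (rule runs_within_mono[OF runs_within_theta_program[OF pos carrier d(1)] total_cost_le])
  then obtain t s where run: "exec theta_program (input_store m n \<xi> \<rho> \<delta> D Xt Q) t s"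
    "theta_output s = theta_star \<xi> \<rho> \<delta> (D - q_mat \<rho> Q Xt)"
    "t \<le> cost_factor * (Suc (m * n) * Suc d)"
    unfolding runs_within_def by blast
  have "real t \<le> real cost_factor * real (Suc (m * n) * Suc d)"
    using run(3) unfolding of_nat_mult[symmetric] of_nat_le_iff .
  also have "\<dots> \<le> real cost_factor * (6 / ln 2 * max 1 (real (m * n) * ln (real (m * n))))"
    using d(2) by (intro mult_left_mono) auto
  finally show ?thesis
    using run(1,2) by (metis mult.assoc)
qed

theorem lemma3p1:
  shows
  "(\<forall>(m::nat) (n::nat) (\<xi>::real) (\<rho>::real) (\<delta>::real) D Xt Q.
      0 < m \<longrightarrow> 0 < n \<longrightarrow>
      D \<in> carrier_mat m n \<longrightarrow> Xt \<in> carrier_mat m n \<longrightarrow> Q \<in> carrier_mat m n \<longrightarrow>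
      \<xi> > 0 \<longrightarrow> \<rho> > 0 \<longrightarrow> \<delta> \<ge> 0 \<longrightarrow>
      (let q = q_mat \<rho> Q Xt; R = D - q in
        (\<delta> > 0 \<longrightarrow>
          (\<not> fro_norm R \<le> \<delta> \<longrightarrow> (\<exists>!\<theta>. \<theta> > 0 \<and> phi \<xi> \<rho> R \<theta> = \<delta>)) \<and>
          (let \<theta> = theta_star \<xi> \<rho> \<delta> R; S = S_star \<xi> \<rho> R \<theta>; X = X_star \<rho> D q \<theta> S in
            \<forall>X' S'. optimal_solution m n \<xi> \<rho> \<delta> D Xt Q X' S' \<longleftrightarrow> X' = X \<and> S' = S)) \<and>
        (\<delta> = 0 \<longrightarrow>
          (let S = shrink R (\<xi> / \<rho>); X = D - S in
            \<forall>X' S'. optimal_solution m n \<xi> \<rho> \<delta> D Xt Q X' S' \<longleftrightarrow> X' = X \<and> S' = S)))) \<and>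
   (\<exists>(prog::com) (C::real).
      \<forall>(m::nat) (n::nat) (\<xi>::real) (\<rho>::real) (\<delta>::real) D Xt Q.
        0 < m \<longrightarrow> 0 < n \<longrightarrow>
        D \<in> carrier_mat m n \<longrightarrow> Xt \<in> carrier_mat m n \<longrightarrow> Q \<in> carrier_mat m n \<longrightarrow>
        \<xi> > 0 \<longrightarrow> \<rho> > 0 \<longrightarrow> \<delta> > 0 \<longrightarrow>
        (\<exists>t s. exec prog (input_store m n \<xi> \<rho> \<delta> D Xt Q) t s \<and>
           theta_output s = theta_star \<xi> \<rho> \<delta> (D - q_mat \<rho> Q Xt) \<and>
           real t \<le> C * max 1 (real (m * n) * ln (real (m * n)))))"
proof (intro conjI allI impI)
  fix m n :: nat and \<xi> \<rho> \<delta> :: real and D Xt Q :: "real mat"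
  assume carrier: "D \<in> carrier_mat m n" "Xt \<in> carrier_mat m n" "Q \<in> carrier_mat m n"
    and pos: "0 < \<xi>" "0 < \<rho>"
  show "let q = q_mat \<rho> Q Xt; R = D - q in
        (\<delta> > 0 \<longrightarrow>
          (\<not> fro_norm R \<le> \<delta> \<longrightarrow> (\<exists>!\<theta>. \<theta> > 0 \<and> phi \<xi> \<rho> R \<theta> = \<delta>)) \<and>
          (let \<theta> = theta_star \<xi> \<rho> \<delta> R; S = S_star \<xi> \<rho> R \<theta>; X = X_star \<rho> D q \<theta> S in
            \<forall>X' S'. optimal_solution m n \<xi> \<rho> \<delta> D Xt Q X' S' \<longleftrightarrow> X' = X \<and> S' = S)) \<and>
        (\<delta> = 0 \<longrightarrow>
          (let S = shrink R (\<xi> / \<rho>); X = D - S in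
            \<forall>X' S'. optimal_solution m n \<xi> \<rho> \<delta> D Xt Q X' S' \<longleftrightarrow> X' = X \<and> S' = S))"
    unfolding Let_def
    using phi_root_unique[OF pos] optimal_solution_closed_form[OF carrier pos]
      optimal_solution_equality_constrained[OF carrier pos] by simp
next
  show "\<exists>(prog::com) (C::real).
      \<forall>(m::nat) (n::nat) (\<xi>::real) (\<rho>::real) (\<delta>::real) D Xt Q.
        0 < m \<longrightarrow> 0 < n \<longrightarrow>
        D \<in> carrier_mat m n \<longrightarrow> Xt \<in> carrier_mat m n \<longrightarrow> Q \<in> carrier_mat m n \<longrightarrow>
        \<xi> > 0 \<longrightarrow> \<rho> > 0 \<longrightarrow> \<delta> > 0 \<longrightarrow>
        (\<exists>t s. exec prog (input_store m n \<xi> \<rho> \<delta> D Xt Q) t s \<and>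
           theta_output s = theta_star \<xi> \<rho> \<delta> (D - q_mat \<rho> Q Xt) \<and>
           real t \<le> C * max 1 (real (m * n) * ln (real (m * n))))"
    by (intro exI[of _ theta_program] exI[of _ "real cost_factor * (6 / ln 2)"] allI impI theta_program_fast)
qed

end
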